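(* Let $X$ be a standard Borel space and $V = (V_x)_{x \in X}$ a Borel field of separable seminormed spaces. Assume that $V' = (V'_x)_{x \in X}$ is any family of separation-completions of $V_x$ with corresponding maps $\gamma_x : V_x \to V'_x$, and let $\gamma=(\gamma_x)_{x\in X} : V\to V'$. Equip $V'$ with the unique standard Borel structure such that $\pi : V'\to X$, $\gamma : V\to V'$ and $V'\times_\pi V'\to[0,+\infty) : (v,w)\mapsto\|v-w\|$ are Borel. Then $V'$ is a Borel field of separable Banach spaces. Moreover, this standard Borel structure on $V'$ is the unique standard Borel structure on $V'$ such that the map $\pi : V' \to X$ and the map $\gamma : V \to V'$ are Borel and such that $V'$ is a Borel field of separable Banach spaces.
   Context: Conventions. A standard Borel space is a measurable space isomorphic to a Borel subset of a Polish space. Product spaces carry the product $\sigma$-algebra and subsets the restricted $\sigma$-algebra. For a family of sets $V = (V_x)_{x\in X}$, the symbol $V$ also denotes the disjoint union of the $V_x$, and $\pi : V \to X$ is the map with $\pi(v) = x$ for $v \in V_x$. $V \times_\pi V = \{(v,w) \in V \times V \mid \pi(v)=\pi(w)\}$. A section is a map $\varphi : X \to V$ with $\varphi(x)\in V_x$ for all $x$. A sequence of Borel sections $\varphi_n : X \to V$ is dense if $\{\varphi_n(x) \mid n\in\mathbb{N}\}$ is dense in $V_x$ for every $x\in X$. A separation-completion of a seminormed space $E$ is a Banach space $E'$ with a linear map $\gamma : E\to E'$ with dense range satisfying $\|\gamma(v)\|=\|v\|$ for all $v\in E$. (For a Borel field of separable seminormed spaces $V$ as below, it is a fact that there is exactly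 one standard Borel structure on $V'$ making $\pi$, $\gamma$ and the metric $(v,w)\mapsto\|v-w\|$ Borel.) A Borel field of separable seminormed spaces (complex scalars) consists of a standard Borel space $X$, a family $V=(V_x)_{x\in X}$ of seminormed spaces and a standard Borel structure on $V$ such that $\pi : V\to X$, addition $V\times_\pi V\to V$, scalar multiplication $\mathbb{C}\times V\to V$ and the seminorm $V\to[0,+\infty) : v\mapsto\|v\|$ are Borel and such that there is a dense sequence of Borel sections $X\to V$ (dense for the seminorm in each $V_x$). A Borel field of separable Banach spaces is defined in exactly the same way, with the $V_x$ being separable Banach spaces. *)

theory Defs
  imports "HOL-Analysis.Analysis" "HOL-Algebra.Module"
begin

section \<open>Standard Borel spaces\<close>

definition polish_topology :: "'a topology \<Rightarrow> bool" where
  "polish_topology T \<longleftrightarrow> separable_space T \<and> completely_metrizable_space T"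

definition borel_of_topology :: "'a topology \<Rightarrow> 'a measure" where
  "borel_of_topology T = sigma (topspace T) {U. openin T U}"

definition measurably_isomorphic :: "'a measure \<Rightarrow> 'b measure \<Rightarrow> bool" where
  "measurably_isomorphic M N \<longleftrightarrow>
     (\<exists>f g. f \<in> M \<rightarrow>\<^sub>M N \<and> g \<in> N \<rightarrow>\<^sub>M M \<and>
        (\<forall>x\<in>space M. g (f x) = x) \<and> (\<forall>y\<in>space N. f (g y) = y))"

text \<open>
  One cannot quantify over types inside a definition, so the Polish space ranges over all
  Polish topologies whose underlying set is some set of reals (the topology itself is arbitrary,
  not the one inherited from the real line). This is no restriction: a Polish space has at most
  continuum many points, so it is homeomorphic to one of this form.
  Of a measure, only the underlying measurable space (space and sets) matters in this theory.
\<close>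

definition standard_borel :: "'a measure \<Rightarrow> bool" where
  "standard_borel M \<longleftrightarrow>
     (\<exists>(T :: real topology) B. polish_topology T \<and> B \<in> sets (borel_of_topology T) \<and>
        measurably_isomorphic M (restrict_space (borel_of_topology T) B))"

section \<open>Seminormed spaces and separation-completions\<close>

text \<open>
  The fibres are vector spaces depending on a parameter, so they are explicit structures:
  complex modules with an explicit carrier set. The ring multiplication and unit fields that the
  record type of modules inherits are never referred to.
\<close>

record 'v seminormed_structure = "(complex, 'v) module" +
  seminorm :: "'v \<Rightarrow> real"

definition complex_ring :: "complex ring" where
  "complex_ring =
     \<lparr>carrier = UNIV, monoid.mult = (*), one = 1, ring.zero = 0, add = (+)\<rparr>"

definition seminormed_space :: "'v seminormed_structure \<Rightarrow> bool" where
  "seminormed_space E \<longleftrightarrow>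
     Module.module complex_ring E \<and>
     (\<forall>v\<in>carrier E. 0 \<le> seminorm E v) \<and>
     (\<forall>c. \<forall>v\<in>carrier E. seminorm E (c \<odot>\<^bsub>E\<^esub> v) = cmod c * seminorm E v) \<and>
     (\<forall>v\<in>carrier E. \<forall>w\<in>carrier E. seminorm E (v \<oplus>\<^bsub>E\<^esub> w) \<le> seminorm E v + seminorm E w)"

text \<open>
  The value 0 off the carrier is a dummy: the locale of metric spaces requires nonnegativity and
  symmetry of the distance on the whole type.
\<close>

definition seminorm_dist :: "'v seminormed_structure \<Rightarrow> 'v \<Rightarrow> 'v \<Rightarrow> real" where
  "seminorm_dist E v w =
     (if v \<in> carrier E \<and> w \<in> carrier E then seminorm E (v \<ominus>\<^bsub>E\<^esub> w) else 0)"

definition seminorm_dense :: "'v seminormed_structure \<Rightarrow> 'v set \<Rightarrow> bool" where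
  "seminorm_dense E D \<longleftrightarrow>
     D \<subseteq> carrier E \<and> (\<forall>v\<in>carrier E. \<forall>\<epsilon>>0. \<exists>d\<in>D. seminorm_dist E v d < \<epsilon>)"

definition banach_space :: "'v seminormed_structure \<Rightarrow> bool" where
  "banach_space E \<longleftrightarrow>
     seminormed_space E \<and>
     (\<forall>v\<in>carrier E. seminorm E v = 0 \<longrightarrow> v = \<zero>\<^bsub>E\<^esub>) \<and>
     Metric_space.mcomplete (carrier E) (seminorm_dist E)"

definition separable_banach_space :: "'v seminormed_structure \<Rightarrow> bool" where
  "separable_banach_space E \<longleftrightarrow>
     banach_space E \<and> separable_space (Metric_space.mtopology (carrier E) (seminorm_dist E))"

definition complex_linear_map ::
    "'v seminormed_structure \<Rightarrow> 'w seminormed_structure \<Rightarrow> ('v \<Rightarrow> 'w) \<Rightarrow> bool" where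
  "complex_linear_map E F f \<longleftrightarrow>
     f \<in> carrier E \<rightarrow> carrier F \<and>
     (\<forall>v\<in>carrier E. \<forall>w\<in>carrier E. f (v \<oplus>\<^bsub>E\<^esub> w) = f v \<oplus>\<^bsub>F\<^esub> f w) \<and>
     (\<forall>c. \<forall>v\<in>carrier E. f (c \<odot>\<^bsub>E\<^esub> v) = c \<odot>\<^bsub>F\<^esub> f v)"

definition separation_completion ::
    "'v seminormed_structure \<Rightarrow> 'w seminormed_structure \<Rightarrow> ('v \<Rightarrow> 'w) \<Rightarrow> bool" where
  "separation_completion E E' \<gamma> \<longleftrightarrow>
     seminormed_space E \<and> banach_space E' \<and>
     complex_linear_map E E' \<gamma> \<and>
     seminorm_dense E' (\<gamma> ` carrier E) \<and>
     (\<forall>v\<in>carrier E. seminorm E' (\<gamma> v) = seminorm E v)"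

section \<open>Borel fields\<close>

text \<open>
  The disjoint union of the fibres is realised as the set of pairs \<open>(x, v)\<close> with \<open>v\<close> in the
  fibre over \<open>x\<close>; accordingly the projection to the base is \<open>fst\<close>.
\<close>

definition total_space :: "'x measure \<Rightarrow> ('x \<Rightarrow> 'v seminormed_structure) \<Rightarrow> ('x \<times> 'v) set" where
  "total_space X V = (SIGMA x : space X. carrier (V x))"

definition standard_borel_structure_on :: "'a set \<Rightarrow> 'a measure \<Rightarrow> bool" where
  "standard_borel_structure_on S M \<longleftrightarrow> space M = S \<and> standard_borel M"

definition fibre_product :: "('x \<times> 'v) measure \<Rightarrow> (('x \<times> 'v) \<times> ('x \<times> 'v)) measure" where
  "fibre_product M =
     restrict_space (M \<Otimes>\<^sub>M M) {(p, q). p \<in> space M \<and> q \<in> space M \<and> fst p = fst q}"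

definition borel_section :: "'x measure \<Rightarrow> ('x \<times> 'v) measure \<Rightarrow> ('x \<Rightarrow> 'x \<times> 'v) \<Rightarrow> bool" where
  "borel_section X M \<phi> \<longleftrightarrow> \<phi> \<in> X \<rightarrow>\<^sub>M M \<and> (\<forall>x\<in>space X. fst (\<phi> x) = x)"

definition borel_field_seminormed ::
    "'x measure \<Rightarrow> ('x \<Rightarrow> 'v seminormed_structure) \<Rightarrow> ('x \<times> 'v) measure \<Rightarrow> bool" where
  "borel_field_seminormed X V M \<longleftrightarrow>
     standard_borel X \<and>
     (\<forall>x\<in>space X. seminormed_space (V x)) \<and>
     standard_borel_structure_on (total_space X V) M \<and>
     fst \<in> M \<rightarrow>\<^sub>M X \<and>
     (\<lambda>((x, v), (_, w)). (x, v \<oplus>\<^bsub>V x\<^esub> w)) \<in> fibre_product M \<rightarrow>\<^sub>M M \<and>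
     (\<lambda>(c, (x, v)). (x, c \<odot>\<^bsub>V x\<^esub> v)) \<in> (borel :: complex measure) \<Otimes>\<^sub>M M \<rightarrow>\<^sub>M M \<and>
     (\<lambda>(x, v). seminorm (V x) v) \<in> M \<rightarrow>\<^sub>M (borel :: real measure) \<and>
     (\<exists>\<phi> :: nat \<Rightarrow> 'x \<Rightarrow> 'x \<times> 'v.
        (\<forall>n. borel_section X M (\<phi> n)) \<and>
        (\<forall>x\<in>space X. seminorm_dense (V x) (range (\<lambda>n. snd (\<phi> n x)))))"

definition borel_field_banach ::
    "'x measure \<Rightarrow> ('x \<Rightarrow> 'v seminormed_structure) \<Rightarrow> ('x \<times> 'v) measure \<Rightarrow> bool" where
  "borel_field_banach X V M \<longleftrightarrow>
     borel_field_seminormed X V M \<and> (\<forall>x\<in>space X. separable_banach_space (V x))"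

definition total_map :: "('x \<Rightarrow> 'v \<Rightarrow> 'w) \<Rightarrow> 'x \<times> 'v \<Rightarrow> 'x \<times> 'w" where
  "total_map \<gamma> = (\<lambda>(x, v). (x, \<gamma> x v))"

definition fibre_metric ::
    "('x \<Rightarrow> 'v seminormed_structure) \<Rightarrow> ('x \<times> 'v) \<times> ('x \<times> 'v) \<Rightarrow> real" where
  "fibre_metric V = (\<lambda>((x, v), (_, w)). seminorm (V x) (v \<ominus>\<^bsub>V x\<^esub> w))"

end

theory Submission
  imports Defs
begin

text \<open>
  Let \<open>\<psi>\<^sub>n = \<gamma> \<circ> \<phi>\<^sub>n\<close> for a dense sequence of Borel sections \<open>\<phi>\<^sub>n\<close> of \<open>V\<close>. The projection to \<open>X\<close> and
  the distances \<open>\<delta>\<^sub>n v = \<parallel>v - \<psi>\<^sub>n(\<pi> v)\<parallel>\<close> are Borel on \<open>V'\<close> and separate points. In a standard Borel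
  space a countable point-separating family of Borel sets generates all Borel sets (Blackwell, by
  Lusin's separation argument), so a map into \<open>V'\<close> is Borel as soon as its compositions with \<open>\<pi>\<close> and
  all \<open>\<delta>\<^sub>n\<close> are. This gives uniqueness, applied to the identity map, and reduces the Borel
  measurability of the vector space operations to that of \<open>\<delta>\<^sub>n(v + w)\<close> and \<open>\<delta>\<^sub>n(c v)\<close>, which are infima
  of expressions in the \<open>\<delta>\<^sub>k\<close> and of seminorms of sections of \<open>V\<close>.
\<close>

section \<open>Point-separating families in standard Borel spaces\<close>

text \<open>Lusin's argument is usually run on Borel sets presented as continuous images of complete
  spaces, or after refining a Polish topology. Here no refined topology and no new metric is built.
  The proof isolates the consequence of completeness that the argument consumes: along a branch of
  countable covers whose finite intersections keep meeting the space there is a limit point, and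
  each designated set containing that point swallows some stage of the branch. This property
  survives countable joins and the adjunction of complements of countable unions, so it reaches all
  Borel sets by induction, and it travels along a measurable isomorphism although the target carries
  no topology.

  On the completion side the obstacle is that no algebraic operation of V' is assumed Borel.
  Choosing approximating sections in a measurable way is avoided: an infimum over all indices takes
  the place of a selection. For uniqueness, a competing Banach field is brought into the same
  setting because its own operations make its metric Borel.\<close>

text \<open>The bound is strict, so stage 0 is the whole type and not the space under consideration;
  this is why cylinders are always intersected with \<open>S\<close> or a subset of it.\<close>

definition cylinder :: "(nat \<Rightarrow> nat \<Rightarrow> 'a set) \<Rightarrow> (nat \<Rightarrow> nat) \<Rightarrow> nat \<Rightarrow> 'a set" where
  "cylinder U \<sigma> n = (\<Inter>k<n. U k (\<sigma> k))"

lemma cylinder_mono: "m \<le> n \<Longrightarrow> cylinder U \<sigma> n \<subseteq> cylinder U \<sigma> m"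
  by (force simp: cylinder_def)

lemma cylinder_Suc: "cylinder U \<sigma> (Suc n) = cylinder U \<sigma> n \<inter> U n (\<sigma> n)"
  by (auto simp: cylinder_def lessThan_Suc)

text \<open>
  A substitute for complete separable metrics in which any countably many Borel sets and their
  complements can be adjoined as open sets: \<open>\<E>\<close> plays the role of a family of open sets, and a
  branch \<open>\<sigma>\<close> through the covers with nonempty finite intersections that of a Cauchy sequence.
\<close>

definition complete_covers :: "'a set \<Rightarrow> (nat \<Rightarrow> nat \<Rightarrow> 'a set) \<Rightarrow> 'a set set \<Rightarrow> bool" where
  "complete_covers S U \<E> \<longleftrightarrow>
     (\<forall>n. S \<subseteq> (\<Union>j. U n j)) \<and>
     (\<forall>\<sigma>. (\<forall>n. S \<inter> cylinder U \<sigma> n \<noteq> {}) \<longrightarrow>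
        (\<exists>x\<in>S. \<forall>E\<in>\<E>. x \<in> E \<longrightarrow> (\<exists>n. S \<inter> cylinder U \<sigma> n \<subseteq> E)))"

definition completable :: "'a set \<Rightarrow> 'a set set \<Rightarrow> bool" where
  "completable S \<E> \<longleftrightarrow> (\<exists>U. complete_covers S U \<E>)"

lemma complete_coversD:
  assumes "complete_covers S U \<E>" "\<And>n. S \<inter> cylinder U \<sigma> n \<noteq> {}"
  obtains x where "x \<in> S" "\<And>E. E \<in> \<E> \<Longrightarrow> x \<in> E \<Longrightarrow> \<exists>n. S \<inter> cylinder U \<sigma> n \<subseteq> E"
  using assms unfolding complete_covers_def by meson

text \<open>The member of a union that contains the limit point already swallows a stage, so the
  same covers serve. This is the passage from a base to arbitrary open sets.\<close>

lemma completable_Unions: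
  assumes "completable S \<E>" "\<And>E. E \<in> \<F> \<Longrightarrow> \<exists>\<G>\<subseteq>\<E>. E = \<Union>\<G>"
  shows "completable S \<F>"
proof -
  obtain U where U: "complete_covers S U \<E>"
    using assms(1) by (auto simp: completable_def)
  have "complete_covers S U \<F>"
    unfolding complete_covers_def
  proof (intro conjI allI impI)
    show "S \<subseteq> (\<Union>j. U n j)" for n
      using U by (auto simp: complete_covers_def)
    fix \<sigma>
    assume "\<forall>n. S \<inter> cylinder U \<sigma> n \<noteq> {}"
    then obtain x where x: "x \<in> S"
      "\<And>E. E \<in> \<E> \<Longrightarrow> x \<in> E \<Longrightarrow> \<exists>n. S \<inter> cylinder U \<sigma> n \<subseteq> E"
      using complete_coversD[OF U] by metis
    have "\<exists>n. S \<inter> cylinder U \<sigma> n \<subseteq> E" if E: "E \<in> \<F>" "x \<in> E" for E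
    proof -
      obtain G where "G \<in> \<E>" "x \<in> G" "G \<subseteq> E"
        using assms(2)[OF E(1)] E(2) by blast
      then show ?thesis
        using x(2) by (meson subset_trans)
    qed
    then show "\<exists>x\<in>S. \<forall>E\<in>\<F>. x \<in> E \<longrightarrow> (\<exists>n. S \<inter> cylinder U \<sigma> n \<subseteq> E)"
      using x(1) by blast
  qed
  then show ?thesis
    by (auto simp: completable_def)
qed

lemma completable_mono:
  assumes "completable S \<E>" "\<F> \<subseteq> \<E>"
  shows "completable S \<F>"
proof (rule completable_Unions[OF assms(1)])
  show "\<exists>\<G>\<subseteq>\<E>. E = \<Union>\<G>" if "E \<in> \<F>" for E
    using that assms(2) by (intro exI[of _ "{E}"]) auto
qed

text \<open>One extra cover is put in front, splitting \<open>S\<close> into the complement of the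
  union and the sets \<open>A k\<close>. A branch that starts in the complement stays in it. A
  branch that starts in \<open>A k\<close> cannot have its limit in the complement:
  \<open>S - A k\<close> would then swallow a stage, which would no longer meet \<open>A k\<close>.
  In topological terms, the complement of a countable union of closed sets becomes open.\<close>

lemma completable_insert_Diff_UN:
  fixes A :: "nat \<Rightarrow> 'a set"
  assumes "completable S \<E>" "\<And>k. S - A k \<in> \<E>"
  shows "completable S (insert (S - (\<Union>k. A k)) \<E>)"
proof -
  obtain U where U: "complete_covers S U \<E>"
    using assms(1) by (auto simp: completable_def)
  define R where "R = (\<lambda>j. case j of 0 \<Rightarrow> S - (\<Union>k. A k) | Suc k \<Rightarrow> A k)"
  define W where "W = (\<lambda>n. case n of 0 \<Rightarrow> R | Suc m \<Rightarrow> U m)"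
  have W: "cylinder W \<sigma> (Suc n) = R (\<sigma> 0) \<inter> cylinder U (\<sigma> \<circ> Suc) n" for n \<sigma>
    by (simp add: cylinder_def lessThan_Suc_eq_insert_0 W_def)
  have "complete_covers S W (insert (S - (\<Union>k. A k)) \<E>)"
    unfolding complete_covers_def
  proof (intro conjI allI impI)
    show "S \<subseteq> (\<Union>j. W n j)" for n
    proof (cases n)
      case 0
      have "x \<in> (\<Union>j. R j)" if "x \<in> S" for x
      proof (cases "x \<in> (\<Union>k. A k)")
        case True
        then obtain k where "x \<in> A k" by auto
        then have "x \<in> R (Suc k)" by (simp add: R_def)
        then show ?thesis by blast
      next
        case False
        then have "x \<in> R 0" using that by (simp add: R_def)
        then show ?thesis by blast
      qed
      then show ?thesis using 0 by (auto simp: W_def)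
    next
      case (Suc m)
      then show ?thesis using U by (auto simp: W_def complete_covers_def)
    qed
    fix \<sigma>
    assume ne: "\<forall>n. S \<inter> cylinder W \<sigma> n \<noteq> {}"
    have neS: "S \<inter> (R (\<sigma> 0) \<inter> cylinder U (\<sigma> \<circ> Suc) n) \<noteq> {}" for n
      using ne[rule_format, of "Suc n"] unfolding W .
    then have "S \<inter> cylinder U (\<sigma> \<circ> Suc) n \<noteq> {}" for n
      by blast
    then obtain x where x: "x \<in> S"
      "\<And>E. E \<in> \<E> \<Longrightarrow> x \<in> E \<Longrightarrow> \<exists>n. S \<inter> cylinder U (\<sigma> \<circ> Suc) n \<subseteq> E"
      using complete_coversD[OF U, where \<sigma> = "\<sigma> \<circ> Suc"] by metis
    have *: "\<exists>n. S \<inter> cylinder W \<sigma> n \<subseteq> E" if "E \<in> \<E>" "x \<in> E" for E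
    proof -
      obtain n where "S \<inter> cylinder U (\<sigma> \<circ> Suc) n \<subseteq> E"
        using x(2)[OF \<open>E \<in> \<E>\<close> \<open>x \<in> E\<close>] by auto
      then have "S \<inter> cylinder W \<sigma> (Suc n) \<subseteq> E"
        unfolding W by blast
      then show ?thesis ..
    qed
    have "\<exists>n. S \<inter> cylinder W \<sigma> n \<subseteq> S - (\<Union>k. A k)" if xA: "x \<in> S - (\<Union>k. A k)"
    proof (cases "\<sigma> 0")
      case 0
      then have "S \<inter> cylinder W \<sigma> (Suc 0) \<subseteq> S - (\<Union>k. A k)"
        unfolding W by (auto simp: R_def)
      then show ?thesis ..
    next
      case (Suc k)
      have "x \<in> S - A k" using xA by auto
      then obtain n where n: "S \<inter> cylinder U (\<sigma> \<circ> Suc) n \<subseteq> S - A k"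
        using x(2)[OF assms(2)] by metis
      have "R (\<sigma> 0) = A k" using Suc by (simp add: R_def)
      then show ?thesis
        using n neS[of n] by blast
    qed
    then show "\<exists>x\<in>S. \<forall>E\<in>insert (S - (\<Union>k. A k)) \<E>. x \<in> E \<longrightarrow> (\<exists>n. S \<inter> cylinder W \<sigma> n \<subseteq> E)"
      using x(1) * by blast
  qed
  then show ?thesis
    by (auto simp: completable_def)
qed

text \<open>The limits obtained from the different cover systems agree because \<open>\<B>\<close> separates points.\<close>

lemma completable_UN:
  fixes \<E> :: "nat \<Rightarrow> 'a set set"
  assumes comp: "\<And>i. completable S (\<E> i)" and sub: "\<And>i. \<B> \<subseteq> \<E> i"
    and Haus: "\<And>x y. x \<in> S \<Longrightarrow> y \<in> S \<Longrightarrow> x \<noteq> y \<Longrightarrow> \<exists>E\<in>\<B>. \<exists>F\<in>\<B>. x \<in> E \<and> y \<in> F \<and> E \<inter> F = {}"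
  shows "completable S (\<Union>i. \<E> i)"
proof -
  obtain U where U: "\<And>i. complete_covers S (U i) (\<E> i)"
    using comp unfolding completable_def by metis
  \<comment> \<open>The cover systems are interleaved through the pairing function, so every branch
    through \<open>W\<close> contains a branch through each \<open>U i\<close>.\<close>
  define W where "W = (\<lambda>n. U (fst (prod_decode n)) (snd (prod_decode n)))"
  \<comment> \<open>Stage \<open>N\<close> refines stage \<open>n\<close> of the system
    \<open>U i\<close> once \<open>N\<close> exceeds the codes of all pairs \<open>(i, k)\<close>
    with \<open>k < n\<close>.\<close>
  have W: "\<exists>N. cylinder W \<sigma> N \<subseteq> cylinder (U i) (\<lambda>k. \<sigma> (prod_encode (i, k))) n" for i n \<sigma>
  proof -
    have "finite ((\<lambda>k. prod_encode (i, k)) ` {..<n})" by simp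
    then obtain N where "\<forall>m \<in> (\<lambda>k. prod_encode (i, k)) ` {..<n}. m < N"
      using finite_nat_set_iff_bounded by blast
    then have N: "\<And>k. k < n \<Longrightarrow> prod_encode (i, k) < N"
      by auto
    have "cylinder W \<sigma> N \<subseteq> U i k (\<sigma> (prod_encode (i, k)))" if "k < n" for k
    proof -
      have "W (prod_encode (i, k)) = U i k" by (simp add: W_def)
      then show ?thesis using N[OF that] unfolding cylinder_def by auto
    qed
    then have "cylinder W \<sigma> N \<subseteq> cylinder (U i) (\<lambda>k. \<sigma> (prod_encode (i, k))) n"
      unfolding cylinder_def[of "U i"] by blast
    then show ?thesis ..
  qed
  have "complete_covers S W (\<Union>i. \<E> i)"
    unfolding complete_covers_def
  proof (intro conjI allI impI)
    show "S \<subseteq> (\<Union>j. W n j)" for n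
      using U[of "fst (prod_decode n)"] unfolding W_def complete_covers_def by blast
    fix \<sigma>
    assume ne: "\<forall>n. S \<inter> cylinder W \<sigma> n \<noteq> {}"
    have neU: "S \<inter> cylinder (U i) (\<lambda>k. \<sigma> (prod_encode (i, k))) n \<noteq> {}" for i n
    proof -
      obtain N where "cylinder W \<sigma> N \<subseteq> cylinder (U i) (\<lambda>k. \<sigma> (prod_encode (i, k))) n"
        using W[where i=i and n=n and \<sigma>=\<sigma>] by (rule exE)
      then show ?thesis using ne[rule_format, of N] by blast
    qed
    have "\<exists>x\<in>S. \<forall>E\<in>\<E> i. x \<in> E \<longrightarrow> (\<exists>n. S \<inter> cylinder (U i) (\<lambda>k. \<sigma> (prod_encode (i, k))) n \<subseteq> E)" for i
      using complete_coversD[OF U, where \<sigma>="\<lambda>k. \<sigma> (prod_encode (i, k))", OF neU] by metis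
    then obtain x where x: "\<And>i. x i \<in> S"
      "\<And>i E. E \<in> \<E> i \<Longrightarrow> x i \<in> E \<Longrightarrow> \<exists>n. S \<inter> cylinder (U i) (\<lambda>k. \<sigma> (prod_encode (i, k))) n \<subseteq> E"
      by metis
    have x': "\<exists>n. S \<inter> cylinder W \<sigma> n \<subseteq> E" if "E \<in> \<E> i" "x i \<in> E" for i E
    proof -
      obtain n where n: "S \<inter> cylinder (U i) (\<lambda>k. \<sigma> (prod_encode (i, k))) n \<subseteq> E"
        using x(2)[OF \<open>E \<in> \<E> i\<close> \<open>x i \<in> E\<close>] by auto
      obtain N where "cylinder W \<sigma> N \<subseteq> cylinder (U i) (\<lambda>k. \<sigma> (prod_encode (i, k))) n"
        using W[where i=i and n=n and \<sigma>=\<sigma>] by (rule exE)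
      with n have "S \<inter> cylinder W \<sigma> N \<subseteq> E" by blast
      then show ?thesis ..
    qed
    have eq: "x i = x 0" for i
    proof (rule ccontr)
      assume "x i \<noteq> x 0"
      then obtain E F where EF: "E \<in> \<B>" "F \<in> \<B>" "x i \<in> E" "x 0 \<in> F" "E \<inter> F = {}"
        using Haus x(1) by metis
      obtain m where m: "S \<inter> cylinder W \<sigma> m \<subseteq> E"
        using x'[OF subsetD[OF sub EF(1)] EF(3)] by (rule exE)
      obtain n where n: "S \<inter> cylinder W \<sigma> n \<subseteq> F"
        using x'[OF subsetD[OF sub EF(2)] EF(4)] by (rule exE)
      have "S \<inter> cylinder W \<sigma> (max m n) \<subseteq> E \<inter> F"
        using m n cylinder_mono[of m "max m n" W \<sigma>] cylinder_mono[of n "max m n" W \<sigma>] by auto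
      then show False using EF(5) ne[rule_format, of "max m n"] by simp
    qed
    show "\<exists>x\<in>S. \<forall>E\<in>\<Union>i. \<E> i. x \<in> E \<longrightarrow> (\<exists>n. S \<inter> cylinder W \<sigma> n \<subseteq> E)"
    proof (intro bexI[of _ "x 0"] ballI impI)
      fix E assume "E \<in> (\<Union>i. \<E> i)" "x 0 \<in> E"
      then obtain i where i: "E \<in> \<E> i" by blast
      moreover have "x i \<in> E" using eq[of i] \<open>x 0 \<in> E\<close> by simp
      ultimately show "\<exists>n. S \<inter> cylinder W \<sigma> n \<subseteq> E" by (rule x')
    qed (rule x(1))
  qed
  then show ?thesis
    by (auto simp: completable_def)
qed

section \<open>Borel sets of Polish spaces and of standard Borel spaces\<close>

lemma polish_dense_sequence:
  assumes "polish_topology T" "topspace T \<noteq> {}"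
  obtains d :: "'a \<Rightarrow> 'a \<Rightarrow> real" and q :: "nat \<Rightarrow> 'a" where
    "Metric_space (topspace T) d" "Metric_space.mcomplete (topspace T) d"
    "T = Metric_space.mtopology (topspace T) d"
    "range q \<subseteq> topspace T" "\<And>x e. x \<in> topspace T \<Longrightarrow> e > 0 \<Longrightarrow> \<exists>n. d (q n) x < e"
proof -
  obtain M d where Md: "Metric_space M d" "Metric_space.mcomplete M d" "T = Metric_space.mtopology M d"
    using assms by (auto simp: polish_topology_def completely_metrizable_space_def)
  interpret Metric_space M d by fact
  have M: "topspace T = M" using Md(3) by simp
  obtain C where C: "countable C" "C \<subseteq> topspace T" "T closure_of C = topspace T"
    using assms by (auto simp: polish_topology_def separable_space_def)
  have "C \<noteq> {}" using C(3) assms(2) closure_of_empty by metis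
  then have q: "range (from_nat_into C) = C"
    using C(1) by (rule range_from_nat_into)
  show thesis
  proof
    show "Metric_space (topspace T) d" "Metric_space.mcomplete (topspace T) d"
      "T = Metric_space.mtopology (topspace T) d"
      unfolding M by fact+
    show "range (from_nat_into C) \<subseteq> topspace T" using q C(2) by simp
    fix x e assume "x \<in> topspace T" "e > (0::real)"
    then have "x \<in> T closure_of C" "x \<in> mball x e" using C(3) by (simp_all add: M)
    moreover have "openin T (mball x e)" using Md(3) openin_mball by simp
    ultimately obtain y where "y \<in> C" "y \<in> mball x e"
      unfolding in_closure_of by blast
    then have "d y x < e" by (simp add: commute)
    then show "\<exists>n. d (from_nat_into C n) x < e"
      using q \<open>y \<in> C\<close> by (metis imageE)
  qed
qed

text \<open>The covers consist of balls of shrinking radius around a dense sequence. Points picked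
  from the stages of a branch form a Cauchy sequence, and its limit is the required point: late
  stages have small diameter and come close to the limit.\<close>

lemma polish_completable_openin:
  assumes "polish_topology T"
  shows "completable (topspace T) {E. openin T E}"
proof (cases "topspace T = {}")
  case True
  then show ?thesis
    by (simp add: completable_def complete_covers_def)
next
  case False
  then obtain d q where dq: "Metric_space (topspace T) d" "Metric_space.mcomplete (topspace T) d"
    "T = Metric_space.mtopology (topspace T) d"
    "range q \<subseteq> topspace T" "\<And>x e. x \<in> topspace T \<Longrightarrow> e > 0 \<Longrightarrow> \<exists>n::nat. d (q n) x < e"
    using polish_dense_sequence[OF assms] by metis
  define S where "S = topspace T"
  interpret Metric_space S d using dq(1) by (simp add: S_def)
  have mc: mcomplete using dq(2) by (simp add: S_def)
  have q: "q j \<in> S" for j using dq(4) by (auto simp: S_def)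
  define U where "U = (\<lambda>(n::nat) j. mball (q j) (inverse (Suc n)))"
  have "complete_covers S U {E. openin T E}"
    unfolding complete_covers_def
  proof (intro conjI allI impI)
    show "S \<subseteq> (\<Union>j. U n j)" for n
    proof
      fix x assume "x \<in> S"
      then obtain j where "d (q j) x < inverse (Suc n)"
        using dq(5)[of x "inverse (real (Suc n))"] by (auto simp: S_def)
      then have "x \<in> U n j" using q \<open>x \<in> S\<close> by (simp add: U_def)
      then show "x \<in> (\<Union>j. U n j)" by blast
    qed
    fix \<sigma>
    assume "\<forall>n. S \<inter> cylinder U \<sigma> n \<noteq> {}"
    then have "\<exists>x. \<forall>n. x n \<in> S \<inter> cylinder U \<sigma> n"
      by (intro choice) blast
    then obtain x where x: "\<And>n. x n \<in> S \<inter> cylinder U \<sigma> n"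
      by metis
    have U2: "d y z < 2 * inverse (Suc n)" if "y \<in> U n j" "z \<in> U n j" for y z n j
      using that triangle'[of y "q j" z] q by (auto simp: U_def commute)
    \<comment> \<open>Stage \<open>m\<close> constrains only the indices below \<open>m\<close>, so
      \<open>x m\<close> lies in the ball with index \<open>n\<close> only if \<open>n < m\<close>.
      This is the origin of the bounds \<open>Suc n\<close> below.\<close>
    have close: "d (x m) y < 2 * inverse (Suc n)" if "n < m" "y \<in> U n (\<sigma> n)" for m n y
      using x[of m] that by (intro U2[of _ n "\<sigma> n"]) (auto simp: cylinder_def)
    have small: "\<exists>n. 2 * inverse (real (Suc n)) < e" if e: "e > 0" for e
    proof -
      obtain n where "inverse (real (Suc n)) < e / 2"
        using e reals_Archimedean[of "e / 2"] by auto
      then show ?thesis by (intro exI[of _ n]) simp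
    qed
    have "MCauchy x"
      unfolding MCauchy_def
    proof (intro conjI allI impI)
      show "range x \<subseteq> S" using x by auto
      fix e :: real assume "e > 0"
      then obtain n where n: "2 * inverse (real (Suc n)) < e" using small by blast
      have "d (x m) (x m') < e" if "Suc n \<le> m" "Suc n \<le> m'" for m m'
      proof -
        have "x m' \<in> U n (\<sigma> n)" using x[of m'] that by (auto simp: cylinder_def)
        then show ?thesis using close[of n m "x m'"] that n by auto
      qed
      then show "\<exists>N. \<forall>n n'. N \<le> n \<longrightarrow> N \<le> n' \<longrightarrow> d (x n) (x n') < e" by blast
    qed
    then obtain l where l: "limitin mtopology x l sequentially"
      using mc unfolding mcomplete_def by blast
    have lS: "l \<in> S" using l limitin_mspace by blast
    have "\<exists>n. S \<inter> cylinder U \<sigma> n \<subseteq> E" if E: "openin T E" "l \<in> E" for E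
    proof -
      have "openin mtopology E" using E(1) dq(3) by (simp add: S_def)
      then obtain r where r: "r > 0" "mball l r \<subseteq> E"
        using E(2) unfolding openin_mtopology by blast
      obtain n where n: "2 * inverse (real (Suc n)) < r / 2" using small[of "r / 2"] r by auto
      obtain N where N: "\<And>m. N \<le> m \<Longrightarrow> d (x m) l < r / 2"
        using l r(1) unfolding limitin_metric eventually_sequentially by (metis half_gt_zero)
      \<comment> \<open>\<open>N\<close> brings \<open>x m\<close> within \<open>r / 2\<close> of
        the limit, and \<open>Suc n\<close> puts it into the same small ball as every point
        \<open>y\<close> of stage \<open>Suc n\<close>.\<close>
      define m where "m = max N (Suc n)"
      have "y \<in> mball l r" if y: "y \<in> S \<inter> cylinder U \<sigma> (Suc n)" for y
      proof -
        have "d (x m) y < 2 * inverse (real (Suc n))"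
          using y by (intro close) (auto simp: m_def cylinder_def)
        moreover have "d (x m) l < r / 2" using N by (simp add: m_def)
        moreover have "d l y \<le> d l (x m) + d (x m) y"
          using x[of m] y lS by (intro triangle) auto
        ultimately show ?thesis
          using n lS y commute[of l "x m"] by auto
      qed
      then show ?thesis using r(2) by blast
    qed
    then show "\<exists>x\<in>S. \<forall>E\<in>{E. openin T E}. x \<in> E \<longrightarrow> (\<exists>n. S \<inter> cylinder U \<sigma> n \<subseteq> E)"
      using lS by blast
  qed
  then show ?thesis
    by (auto simp: completable_def S_def)
qed

lemma polish_Hausdorff:
  assumes "polish_topology T" "x \<in> topspace T" "y \<in> topspace T" "x \<noteq> y"
  shows "\<exists>E\<in>{E. openin T E}. \<exists>F\<in>{E. openin T E}. x \<in> E \<and> y \<in> F \<and> E \<inter> F = {}"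
proof -
  have "Hausdorff_space T"
    using assms(1) completely_metrizable_imp_metrizable_space metrizable_imp_Hausdorff_space
    unfolding polish_topology_def by blast
  then obtain E F where "openin T E" "openin T F" "x \<in> E" "y \<in> F" "disjnt E F"
    using assms(2-4) unfolding Hausdorff_space_def by metis
  then show ?thesis
    by (auto simp: disjnt_def intro!: bexI[of _ E] bexI[of _ F])
qed

text \<open>The induction carries a set together with its complement, which makes the complement
  case symmetric. It also keeps all open sets in the family, because the union case joins countably
  many cover systems and needs a common Hausdorff subfamily to identify their limits.\<close>

lemma polish_completable_borel:
  assumes T: "polish_topology T" and A: "A \<in> sigma_sets (topspace T) {E. openin T E}"
  shows "completable (topspace T) ({E. openin T E} \<union> {A, topspace T - A})"
  using A
proof induction
  case (Basic A)
  \<comment> \<open>In a metrizable space an open set is a countable union of closed sets, and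
    complements of such unions can be adjoined.\<close>
  then have "fsigma_in T A"
    using T completely_metrizable_imp_metrizable_space open_imp_fsigma_in
    unfolding polish_topology_def by blast
  then obtain C where C: "\<And>n::nat. closedin T (C n)" "\<Union> (range C) = A"
    unfolding fsigma_in_ascending by blast
  have "completable (topspace T) (insert (topspace T - (\<Union>n. C n)) {E. openin T E})"
    using C(1) by (intro completable_insert_Diff_UN polish_completable_openin T) auto
  then show ?case
    using C(2) Basic by (auto intro: completable_mono)
next
  case Empty
  show ?case
    by (rule completable_mono[OF polish_completable_openin[OF T]]) auto
next
  case (Compl A)
  have "A \<subseteq> topspace T"
    using Compl(1) by (rule sigma_sets_into_sp[rotated]) (auto dest: openin_subset)
  then have "topspace T - (topspace T - A) = A" by blast
  then show ?case using Compl(2) by (simp add: insert_commute)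
next
  case (Union A)
  let ?E = "\<lambda>i. {E. openin T E} \<union> {A i, topspace T - A i}"
  have "completable (topspace T) (\<Union>i. ?E i)"
  proof (rule completable_UN[where \<B> = "{E. openin T E}"])
    show "completable (topspace T) (?E i)" for i by (rule Union)
    show "\<exists>E\<in>{E. openin T E}. \<exists>F\<in>{E. openin T E}. x \<in> E \<and> y \<in> F \<and> E \<inter> F = {}"
      if "x \<in> topspace T" "y \<in> topspace T" "x \<noteq> y" for x y
      using polish_Hausdorff[OF T that] .
  qed auto
  \<comment> \<open>Only the complement of the union calls for a new cover; the union itself is a
    union of members \<open>A i\<close> already present.\<close>
  then have *: "completable (topspace T) (insert (topspace T - (\<Union>i. A i)) (\<Union>i. ?E i))"
    by (rule completable_insert_Diff_UN) auto
  show ?case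
  proof (rule completable_Unions[OF *])
    fix E assume E: "E \<in> {E. openin T E} \<union> {\<Union> (range A), topspace T - \<Union> (range A)}"
    then consider "E = \<Union> (range A)" | "E \<in> insert (topspace T - (\<Union>i. A i)) (\<Union>i. ?E i)"
      by auto
    then show "\<exists>\<G>\<subseteq>insert (topspace T - (\<Union>i. A i)) (\<Union>i. ?E i). E = \<Union> \<G>"
    proof cases
      case 1
      then show ?thesis by (intro exI[of _ "range A"]) auto
    next
      case 2
      then show ?thesis by (intro exI[of _ "{E}"]) auto
    qed
  qed
qed

lemma sets_borel_of_topology: "sets (borel_of_topology T) = sigma_sets (topspace T) {E. openin T E}"
  unfolding borel_of_topology_def by (rule sets_measure_of) (auto dest: openin_subset)

lemma space_borel_of_topology: "space (borel_of_topology T) = topspace T"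
  unfolding borel_of_topology_def by (rule space_measure_of) (auto dest: openin_subset)

lemma polish_completable_countable:
  fixes A :: "nat \<Rightarrow> 'a set"
  assumes T: "polish_topology T" and A: "\<And>i. A i \<in> sets (borel_of_topology T)"
  shows "completable (topspace T) (range A)"
proof -
  let ?E = "\<lambda>i. {E. openin T E} \<union> {A i, topspace T - A i}"
  have "completable (topspace T) (\<Union>i. ?E i)"
  proof (rule completable_UN[where \<B> = "{E. openin T E}"])
    show "completable (topspace T) (?E i)" for i
      using polish_completable_borel[OF T] A by (simp add: sets_borel_of_topology)
    show "\<exists>E\<in>{E. openin T E}. \<exists>F\<in>{E. openin T E}. x \<in> E \<and> y \<in> F \<and> E \<inter> F = {}"
      if "x \<in> topspace T" "y \<in> topspace T" "x \<noteq> y" for x y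
      using polish_Hausdorff[OF T that] .
  qed auto
  then show ?thesis
    by (rule completable_mono) auto
qed

text \<open>Covers of the Polish space are pulled back along \<open>f\<close>, and the limit found
  there is carried back by \<open>g\<close>.\<close>

lemma standard_borel_completable:
  fixes \<E> :: "'a set set"
  assumes M: "standard_borel M" and \<E>: "countable \<E>" "\<E> \<subseteq> sets M"
  shows "completable (space M) \<E>"
proof -
  \<comment> \<open>Inserting the empty set allows an enumeration by all natural numbers even when
    \<open>\<E>\<close> is empty.\<close>
  define A where "A = from_nat_into (insert {} \<E>)"
  have ran: "range A = insert {} \<E>"
    unfolding A_def using \<E>(1) by (intro range_from_nat_into) auto
  then have A: "A i \<in> sets M" for i
    using \<E>(2) by (metis insertE rangeI sets.empty_sets subsetD)
  obtain T :: "real topology" and B f g where T: "polish_topology T"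
    and B: "B \<in> sets (borel_of_topology T)"
    and f: "f \<in> M \<rightarrow>\<^sub>M restrict_space (borel_of_topology T) B"
    and g: "g \<in> restrict_space (borel_of_topology T) B \<rightarrow>\<^sub>M M"
    and gf: "\<And>x. x \<in> space M \<Longrightarrow> g (f x) = x"
    using M unfolding standard_borel_def measurably_isomorphic_def by metis
  let ?S = "topspace T" and ?R = "restrict_space (borel_of_topology T) B"
  have BS: "B \<subseteq> ?S"
    using sets.sets_into_space[OF B] by (simp add: space_borel_of_topology)
  then have spR: "space ?R = B"
    by (auto simp: space_restrict_space space_borel_of_topology)
  have fB: "f x \<in> B" if "x \<in> space M" for x
    using measurable_space[OF f that] spR by simp
  \<comment> \<open>Entry 0 forces limits into \<open>B\<close>, where \<open>g\<close> is
    controlled: a limit outside \<open>B\<close> would have a stage outside \<open>B\<close>, but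
    each stage contains some \<open>f y\<close>, which lies in \<open>B\<close>.\<close>
  define D where "D = (\<lambda>i. case i of 0 \<Rightarrow> ?S - B | Suc k \<Rightarrow> g -` A k \<inter> B)"
  have "g -` A k \<inter> B \<in> sets (borel_of_topology T)" for k
  proof -
    have "g -` A k \<inter> space ?R \<in> sets ?R"
      using measurable_sets[OF g A] .
    then show ?thesis
      unfolding spR using B sets_restrict_space_iff[of B "borel_of_topology T"]
      by (metis BS Int_absorb2 sets.Int sets.top space_borel_of_topology)
  qed
  moreover have "?S - B \<in> sets (borel_of_topology T)"
    using sets.compl_sets[OF B] by (simp add: space_borel_of_topology)
  ultimately have "D i \<in> sets (borel_of_topology T)" for i
    by (simp add: D_def split: nat.split)
  then obtain U where U: "complete_covers ?S U (range D)"
    using polish_completable_countable[OF T] unfolding completable_def by metis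
  define W where "W = (\<lambda>n j. f -` U n j)"
  have "complete_covers (space M) W (range A)"
    unfolding complete_covers_def
  proof (intro conjI allI impI)
    show "space M \<subseteq> (\<Union>j. W n j)" for n
    proof
      fix x assume "x \<in> space M"
      then have "f x \<in> ?S" using fB BS by auto
      then have "f x \<in> (\<Union>j. U n j)" using U unfolding complete_covers_def by blast
      then show "x \<in> (\<Union>j. W n j)" by (simp add: W_def)
    qed
    fix \<sigma>
    assume ne: "\<forall>n. space M \<inter> cylinder W \<sigma> n \<noteq> {}"
    have sub: "f y \<in> ?S \<inter> cylinder U \<sigma> n" if "y \<in> space M \<inter> cylinder W \<sigma> n" for y n
      using that fB BS by (auto simp: W_def cylinder_def)
    have "?S \<inter> cylinder U \<sigma> n \<noteq> {}" for n
      using ne sub by blast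
    then obtain x where x: "x \<in> ?S"
      "\<And>E. E \<in> range D \<Longrightarrow> x \<in> E \<Longrightarrow> \<exists>n. ?S \<inter> cylinder U \<sigma> n \<subseteq> E"
      using complete_coversD[OF U] by metis
    have xB: "x \<in> B"
    proof (rule ccontr)
      assume "x \<notin> B"
      then have "x \<in> D 0" using x(1) by (simp add: D_def)
      then obtain n where n: "?S \<inter> cylinder U \<sigma> n \<subseteq> D 0" using x(2) by blast
      obtain y where y: "y \<in> space M \<inter> cylinder W \<sigma> n" using ne by blast
      then have "f y \<in> D 0" using sub n by blast
      then show False using fB y by (simp add: D_def)
    qed
    have "\<exists>n. space M \<inter> cylinder W \<sigma> n \<subseteq> A i" if "g x \<in> A i" for i
    proof -
      have "x \<in> D (Suc i)" using that xB by (simp add: D_def)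
      then obtain n where n: "?S \<inter> cylinder U \<sigma> n \<subseteq> D (Suc i)" using x(2) by blast
      have "y \<in> A i" if y: "y \<in> space M \<inter> cylinder W \<sigma> n" for y
      proof -
        have "f y \<in> D (Suc i)" using sub[OF y] n by blast
        then show ?thesis using gf y by (simp add: D_def)
      qed
      then show ?thesis by blast
    qed
    moreover have "g x \<in> space M" using measurable_space[OF g] xB spR by simp
    ultimately show "\<exists>x\<in>space M. \<forall>E\<in>range A. x \<in> E \<longrightarrow> (\<exists>n. space M \<inter> cylinder W \<sigma> n \<subseteq> E)"
      by blast
  qed
  then have "completable (space M) (range A)"
    by (auto simp: completable_def)
  then show ?thesis
    by (rule completable_mono) (simp add: ran subset_insertI)
qed

section \<open>Lusin separation and Blackwell's theorem\<close>

text \<open>An inseparable pair can be cut down to pieces of the covers, one cover after the other,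
  and stay inseparable. The two resulting branches have limits, which lie in \<open>C\<close> and
  \<open>D\<close> because the complements of these sets belong to \<open>\<E>\<close>. A set
  separating the two limits, which belongs to \<open>\<E>\<close> with its complement, then
  separates two late stages.\<close>

lemma lusin_separation:
  assumes "sigma_algebra S \<Sigma>" "completable S \<E>"
    and C: "C \<subseteq> S" "S - C \<in> \<E>" and D: "D \<subseteq> S" "S - D \<in> \<E>"
    and sep: "\<And>x y. x \<in> C \<Longrightarrow> y \<in> D \<Longrightarrow> \<exists>A\<in>\<Sigma>. x \<in> A \<and> y \<notin> A \<and> A \<in> \<E> \<and> S - A \<in> \<E>"
  shows "\<exists>A\<in>\<Sigma>. C \<subseteq> A \<and> D \<inter> A = {}"
proof (rule ccontr)
  interpret sigma_algebra S \<Sigma> by fact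
  define insep where "insep = (\<lambda>P. \<not> (\<exists>A\<in>\<Sigma>. fst P \<subseteq> A \<and> snd P \<inter> A = {}))"
  assume "\<not> (\<exists>A\<in>\<Sigma>. C \<subseteq> A \<and> D \<inter> A = {})"
  then have init: "insep (C, D)" by (simp add: insep_def)
  obtain U where U: "complete_covers S U \<E>"
    using assms(2) by (auto simp: completable_def)
  have step: "\<exists>i j. insep (fst P \<inter> U n i, snd P \<inter> U n j)"
    if P: "insep P" "fst P \<subseteq> S" "snd P \<subseteq> S" for P n
  proof (rule ccontr)
    assume "\<nexists>i j. insep (fst P \<inter> U n i, snd P \<inter> U n j)"
    then have "\<forall>i j. \<exists>A. A \<in> \<Sigma> \<and> fst P \<inter> U n i \<subseteq> A \<and> snd P \<inter> U n j \<inter> A = {}"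
      by (simp add: insep_def) blast
    then obtain A where A: "\<And>i j. A i j \<in> \<Sigma>" "\<And>i j. fst P \<inter> U n i \<subseteq> A i j"
      "\<And>i j. snd P \<inter> U n j \<inter> A i j = {}"
      by metis
    \<comment> \<open>If all pairs of pieces were separated by sets \<open>A i j\<close>, this set
      would separate the whole pair: a point of the first set in piece \<open>i\<close> lies in
      every \<open>A i j\<close>, and a point of the second set in piece \<open>j\<close> avoids
      \<open>A i j\<close> for every \<open>i\<close>.\<close>
    define B where "B = (\<Union>i. \<Inter>j. A i j)"
    have cov: "S \<subseteq> (\<Union>j. U n j)" using U by (auto simp: complete_covers_def)
    have "B \<in> \<Sigma>" unfolding B_def using A(1) by (intro countable_UN countable_INT) auto
    moreover have "fst P \<subseteq> B"
    proof
      fix x assume "x \<in> fst P"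
      then obtain i where "x \<in> U n i" using cov P(2) by blast
      then have "x \<in> A i j" for j using A(2) \<open>x \<in> fst P\<close> by blast
      then show "x \<in> B" by (auto simp: B_def)
    qed
    moreover have "snd P \<inter> B = {}"
    proof -
      have "x \<notin> B" if x: "x \<in> snd P" for x
      proof -
        obtain j where "x \<in> U n j" using cov P(3) x by blast
        then have "x \<notin> A i j" for i using A(3) x by blast
        then show ?thesis by (auto simp: B_def)
      qed
      then show ?thesis by blast
    qed
    ultimately show False using P(1) by (auto simp: insep_def)
  qed
  define ok where "ok = (\<lambda>P. insep P \<and> fst P \<subseteq> S \<and> snd P \<subseteq> S)"
  have "\<exists>P. \<forall>n. (ok (P n) \<and> (n = 0 \<longrightarrow> P n = (C, D))) \<and>
      (\<exists>i j. P (Suc n) = (fst (P n) \<inter> U n i, snd (P n) \<inter> U n j))"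
  proof (rule dependent_nat_choice)
    show "\<exists>x. ok x \<and> (0 = (0::nat) \<longrightarrow> x = (C, D))"
      using init C(1) D(1) by (simp add: ok_def)
    fix P and n :: nat
    assume "ok P \<and> (n = 0 \<longrightarrow> P = (C, D))"
    then have P: "insep P" "fst P \<subseteq> S" "snd P \<subseteq> S" by (auto simp: ok_def)
    obtain i j where "insep (fst P \<inter> U n i, snd P \<inter> U n j)"
      using step[OF P] by blast
    then have "ok (fst P \<inter> U n i, snd P \<inter> U n j)"
      using P by (auto simp: ok_def)
    then show "\<exists>y. (ok y \<and> (Suc n = 0 \<longrightarrow> y = (C, D))) \<and>
        (\<exists>i j. y = (fst P \<inter> U n i, snd P \<inter> U n j))"
      by blast
  qed
  then obtain P where P: "\<And>n. ok (P n)" "P 0 = (C, D)"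
    "\<And>n. \<exists>i j. P (Suc n) = (fst (P n) \<inter> U n i, snd (P n) \<inter> U n j)"
    by metis
  then obtain \<sigma> \<tau> where st: "\<And>n. P (Suc n) = (fst (P n) \<inter> U n (\<sigma> n), snd (P n) \<inter> U n (\<tau> n))"
    by metis
  have Pn: "P n = (C \<inter> cylinder U \<sigma> n, D \<inter> cylinder U \<tau> n)" for n
    by (induction n) (auto simp: P(2) st cylinder_Suc, auto simp: cylinder_def)
  have ins: "\<not> (\<exists>A\<in>\<Sigma>. C \<inter> cylinder U \<sigma> n \<subseteq> A \<and> D \<inter> cylinder U \<tau> n \<inter> A = {})" for n
    using P(1)[of n] by (simp add: ok_def insep_def Pn)
  \<comment> \<open>An empty set is separated trivially, by the empty set or by the whole space, so
    inseparability keeps all stages nonempty.\<close>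
  have neC: "C \<inter> cylinder U \<sigma> n \<noteq> {}" for n
    using ins[of n] by (metis empty_sets empty_subsetI inf_bot_right)
  have neD: "D \<inter> cylinder U \<tau> n \<noteq> {}" for n
    using ins[of n] top C(1) by (metis Int_empty_left inf.coboundedI1)
  have "S \<inter> cylinder U \<sigma> n \<noteq> {}" for n using neC[of n] C(1) by blast
  then obtain x where x: "x \<in> S"
    "\<And>E. E \<in> \<E> \<Longrightarrow> x \<in> E \<Longrightarrow> \<exists>n. S \<inter> cylinder U \<sigma> n \<subseteq> E"
    using complete_coversD[OF U] by metis
  have "S \<inter> cylinder U \<tau> n \<noteq> {}" for n using neD[of n] D(1) by blast
  then obtain y where y: "y \<in> S"
    "\<And>E. E \<in> \<E> \<Longrightarrow> y \<in> E \<Longrightarrow> \<exists>n. S \<inter> cylinder U \<tau> n \<subseteq> E"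
    using complete_coversD[OF U] by metis
  have "x \<in> C"
  proof (rule ccontr)
    assume "x \<notin> C"
    then obtain n where "S \<inter> cylinder U \<sigma> n \<subseteq> S - C" using x C(2) by blast
    then show False using neC[of n] C(1) by blast
  qed
  moreover have "y \<in> D"
  proof (rule ccontr)
    assume "y \<notin> D"
    then obtain n where "S \<inter> cylinder U \<tau> n \<subseteq> S - D" using y D(2) by blast
    then show False using neD[of n] D(1) by blast
  qed
  ultimately obtain A where A: "A \<in> \<Sigma>" "x \<in> A" "y \<notin> A" "A \<in> \<E>" "S - A \<in> \<E>"
    using sep by metis
  obtain m where m: "S \<inter> cylinder U \<sigma> m \<subseteq> A" using x A by blast
  obtain n where n: "S \<inter> cylinder U \<tau> n \<subseteq> S - A" using y A by blast
  have "C \<inter> cylinder U \<sigma> (max m n) \<subseteq> A"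
    using m C(1) cylinder_mono[of m "max m n" U \<sigma>] by (meson Int_mono max.cobounded1 subset_trans)
  moreover have "D \<inter> cylinder U \<tau> (max m n) \<subseteq> S - A"
    using n D(1) cylinder_mono[of n "max m n" U \<tau>] by (meson Int_mono max.cobounded2 subset_trans)
  ultimately show False using ins[of "max m n"] A(1) by blast
qed

text \<open>A set separating \<open>C\<close> from its complement can only be \<open>C\<close>. The
  generators are measurable and countable in number, so they, \<open>C\<close> and all their
  complements can be handled by a single system of covers; this is done for each \<open>C\<close>
  anew.\<close>

theorem standard_borel_sets_eq_sigma_sets:
  assumes M: "standard_borel M" and \<A>: "countable \<A>" "\<A> \<subseteq> sets M"
    and sep: "\<And>x y. x \<in> space M \<Longrightarrow> y \<in> space M \<Longrightarrow> x \<noteq> y \<Longrightarrow> \<exists>A\<in>\<A>. (x \<in> A) \<noteq> (y \<in> A)"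
  shows "sets M = sigma_sets (space M) \<A>"
proof
  show "sigma_sets (space M) \<A> \<subseteq> sets M"
    using \<A>(2) by (rule sets.sigma_sets_subset)
  let ?S = "space M"
  have AS: "A \<subseteq> ?S" if "A \<in> \<A>" for A using that \<A>(2) sets.sets_into_space by blast
  have SA: "sigma_algebra ?S (sigma_sets ?S \<A>)"
    using AS by (intro sigma_algebra_sigma_sets) auto
  show "sets M \<subseteq> sigma_sets ?S \<A>"
  proof
    fix C assume C: "C \<in> sets M"
    then have CS: "C \<subseteq> ?S" by (rule sets.sets_into_space)
    define \<E> where "\<E> = {C, ?S - C} \<union> \<A> \<union> (\<lambda>A. ?S - A) ` \<A>"
    have comp: "completable ?S \<E>"
      unfolding \<E>_def using \<A> C by (intro standard_borel_completable[OF M]) auto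
    have "\<exists>A\<in>sigma_sets ?S \<A>. C \<subseteq> A \<and> (?S - C) \<inter> A = {}"
    proof (rule lusin_separation[OF SA comp])
      show "?S - C \<in> \<E>" "?S - (?S - C) \<in> \<E>"
        using CS by (auto simp: \<E>_def double_diff)
      fix x y assume xy: "x \<in> C" "y \<in> ?S - C"
      then obtain A where A: "A \<in> \<A>" "(x \<in> A) \<noteq> (y \<in> A)"
        using sep[of x y] CS by blast
      have mem: "A \<in> \<E>" "?S - A \<in> \<E>" "?S - (?S - A) \<in> \<E>"
        using A(1) AS[OF A(1)] by (auto simp: \<E>_def double_diff)
      have sig: "A \<in> sigma_sets ?S \<A>" "?S - A \<in> sigma_sets ?S \<A>"
        using A(1) by (auto intro: sigma_sets.intros)
      show "\<exists>A\<in>sigma_sets ?S \<A>. x \<in> A \<and> y \<notin> A \<and> A \<in> \<E> \<and> ?S - A \<in> \<E>"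
      proof (cases "x \<in> A")
        case True
        then show ?thesis using A mem sig by blast
      next
        case False
        then show ?thesis using A mem sig xy CS by (intro bexI[of _ "?S - A"]) auto
      qed
    qed (use CS in auto)
    then obtain A where A: "A \<in> sigma_sets ?S \<A>" "C \<subseteq> A" "(?S - C) \<inter> A = {}" by blast
    moreover have "A \<subseteq> ?S"
      using sigma_sets_into_sp[of \<A> ?S A] AS A(1) by blast
    ultimately have "A = C" by blast
    then show "C \<in> sigma_sets ?S \<A>" using A(1) by simp
  qed
qed

section \<open>Countable separation of points\<close>

lemma polish_countably_separated:
  assumes T: "polish_topology T"
  obtains \<B> where "countable \<B>" "\<And>E. E \<in> \<B> \<Longrightarrow> openin T E"
    "\<And>x y. x \<in> topspace T \<Longrightarrow> y \<in> topspace T \<Longrightarrow> x \<noteq> y \<Longrightarrow> \<exists>E\<in>\<B>. (x \<in> E) \<noteq> (y \<in> E)"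
proof (cases "topspace T = {}")
  case True
  then show ?thesis using that[of "{}"] by simp
next
  case False
  then obtain d q where dq: "Metric_space (topspace T) d"
    "T = Metric_space.mtopology (topspace T) d"
    "range q \<subseteq> topspace T" "\<And>x e. x \<in> topspace T \<Longrightarrow> e > 0 \<Longrightarrow> \<exists>n::nat. d (q n) x < e"
    using polish_dense_sequence[OF T] by metis
  define S where "S = topspace T"
  interpret Metric_space S d using dq(1) by (simp add: S_def)
  have q: "q j \<in> S" for j using dq(3) by (auto simp: S_def)
  have T_eq: "T = mtopology" using dq(2) by (simp add: S_def)
  define \<B> where "\<B> = range (\<lambda>(i, n::nat). mball (q i) (inverse (Suc n)))"
  show ?thesis
  proof (rule that[of \<B>])
    show "countable \<B>" by (simp add: \<B>_def)
    show "openin T E" if "E \<in> \<B>" for E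
      using that unfolding \<B>_def T_eq by auto
    fix x y assume xy: "x \<in> topspace T" "y \<in> topspace T" "x \<noteq> y"
    then have xyS: "x \<in> S" "y \<in> S" by (auto simp: S_def)
    then have "d x y > 0" using xy(3) by simp
    \<comment> \<open>A ball of radius below half of \<open>d x y\<close> that contains
      \<open>x\<close> cannot contain \<open>y\<close>.\<close>
    then obtain n where n: "inverse (real (Suc n)) < d x y / 2"
      using reals_Archimedean[of "d x y / 2"] by auto
    obtain i where i: "d (q i) x < inverse (Suc n)"
      using dq(4)[OF xy(1), of "inverse (real (Suc n))"] by auto
    have "\<not> d (q i) y < inverse (Suc n)"
      using i n triangle'[of x "q i" y] xyS q[of i] commute[of "q i" x] commute[of "q i" y] by auto
    then show "\<exists>E\<in>\<B>. (x \<in> E) \<noteq> (y \<in> E)"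
      using i xyS q by (intro bexI[of _ "mball (q i) (inverse (Suc n))"]) (auto simp: \<B>_def)
  qed
qed

text \<open>Distances to sections distinguish points of one fibre; this family, pulled back from a
  Polish space along an injective map, distinguishes the base points.\<close>

lemma standard_borel_countably_separated:
  assumes M: "standard_borel M"
  obtains \<A> where "countable \<A>" "\<A> \<subseteq> sets M"
    "\<And>x y. x \<in> space M \<Longrightarrow> y \<in> space M \<Longrightarrow> x \<noteq> y \<Longrightarrow> \<exists>A\<in>\<A>. (x \<in> A) \<noteq> (y \<in> A)"
proof -
  obtain T :: "real topology" and B f g where T: "polish_topology T"
    and B: "B \<in> sets (borel_of_topology T)"
    and f: "f \<in> M \<rightarrow>\<^sub>M restrict_space (borel_of_topology T) B"
    and gf: "\<And>x. x \<in> space M \<Longrightarrow> g (f x) = x"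
    using M unfolding standard_borel_def measurably_isomorphic_def by metis
  obtain \<B> where \<B>: "countable \<B>" "\<And>E. E \<in> \<B> \<Longrightarrow> openin T E"
    "\<And>x y. x \<in> topspace T \<Longrightarrow> y \<in> topspace T \<Longrightarrow> x \<noteq> y \<Longrightarrow> \<exists>E\<in>\<B>. (x \<in> E) \<noteq> (y \<in> E)"
    using polish_countably_separated[OF T] by metis
  have f': "f \<in> M \<rightarrow>\<^sub>M borel_of_topology T"
    using f by (rule measurable_restrict_space2_iff[THEN iffD1, THEN conjunct1])
  show ?thesis
  proof (rule that[of "(\<lambda>E. f -` E \<inter> space M) ` \<B>"])
    show "countable ((\<lambda>E. f -` E \<inter> space M) ` \<B>)" using \<B>(1) by simp
    have "E \<in> sets (borel_of_topology T)" if "E \<in> \<B>" for E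
      using \<B>(2)[OF that] by (auto simp: sets_borel_of_topology)
    then show "(\<lambda>E. f -` E \<inter> space M) ` \<B> \<subseteq> sets M"
      using measurable_sets[OF f'] by auto
    fix x y assume xy: "x \<in> space M" "y \<in> space M" "x \<noteq> y"
    then have "f x \<noteq> f y" "f x \<in> topspace T" "f y \<in> topspace T"
      using gf measurable_space[OF f'] by (metis, auto simp: space_borel_of_topology)
    then obtain E where "E \<in> \<B>" "(f x \<in> E) \<noteq> (f y \<in> E)" using \<B>(3) by metis
    then show "\<exists>A\<in>(\<lambda>E. f -` E \<inter> space M) ` \<B>. (x \<in> A) \<noteq> (y \<in> A)"
      using xy by auto
  qed
qed

section \<open>Seminormed spaces and completions\<close>

lemma carrier_complex_ring [simp]: "carrier complex_ring = UNIV"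
  and one_complex_ring [simp]: "\<one>\<^bsub>complex_ring\<^esub> = 1"
  and add_complex_ring [simp]: "a \<oplus>\<^bsub>complex_ring\<^esub> b = a + b"
  and zero_complex_ring [simp]: "\<zero>\<^bsub>complex_ring\<^esub> = 0"
  by (simp_all add: complex_ring_def)

locale seminormed =
  fixes E :: "'v seminormed_structure"
  assumes seminormed: "seminormed_space E"

sublocale seminormed \<subseteq> module complex_ring E
  using seminormed by (simp add: seminormed_space_def)

context seminormed
begin

lemma seminorm_nonneg: "v \<in> carrier E \<Longrightarrow> 0 \<le> seminorm E v"
  using seminormed by (simp add: seminormed_space_def)

lemma seminorm_smult: "v \<in> carrier E \<Longrightarrow> seminorm E (c \<odot>\<^bsub>E\<^esub> v) = cmod c * seminorm E v"
  using seminormed by (simp add: seminormed_space_def)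

lemma seminorm_add:
  "v \<in> carrier E \<Longrightarrow> w \<in> carrier E \<Longrightarrow> seminorm E (v \<oplus>\<^bsub>E\<^esub> w) \<le> seminorm E v + seminorm E w"
  using seminormed by (simp add: seminormed_space_def)

lemma smult_minus_one:
  assumes "v \<in> carrier E"
  shows "(-1) \<odot>\<^bsub>E\<^esub> v = \<ominus>\<^bsub>E\<^esub> v"
proof -
  have "\<ominus>\<^bsub>complex_ring\<^esub> 1 = -1"
    by (rule R.minus_equality) simp_all
  then show ?thesis
    using smult_l_minus[of 1 v] smult_one[of v] assms by simp
qed

text \<open>Linear maps and Borel fields are described through addition and scalar multiplication,
  so differences are reduced to these two operations.\<close>

lemma minus_eq_smult:
  assumes "v \<in> carrier E" "w \<in> carrier E"
  shows "v \<ominus>\<^bsub>E\<^esub> w = v \<oplus>\<^bsub>E\<^esub> ((-1) \<odot>\<^bsub>E\<^esub> w)"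
  using assms by (simp add: smult_minus_one a_minus_def)

lemma smult_minus_distr:
  assumes "v \<in> carrier E" "w \<in> carrier E"
  shows "c \<odot>\<^bsub>E\<^esub> (v \<ominus>\<^bsub>E\<^esub> w) = c \<odot>\<^bsub>E\<^esub> v \<ominus>\<^bsub>E\<^esub> c \<odot>\<^bsub>E\<^esub> w"
  using assms by (simp add: a_minus_def smult_r_distr smult_r_minus)

lemma seminorm_minus: "v \<in> carrier E \<Longrightarrow> seminorm E (\<ominus>\<^bsub>E\<^esub> v) = seminorm E v"
  using seminorm_smult[of v "-1"] by (simp add: smult_minus_one)

lemma seminorm_zero: "seminorm E \<zero>\<^bsub>E\<^esub> = 0"
  using seminorm_smult[of "\<zero>\<^bsub>E\<^esub>" 0] by simp

lemma minus_swap: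
  assumes "v \<in> carrier E" "w \<in> carrier E"
  shows "\<ominus>\<^bsub>E\<^esub> (v \<ominus>\<^bsub>E\<^esub> w) = w \<ominus>\<^bsub>E\<^esub> v"
  using assms by (simp add: a_minus_def M.minus_add M.a_comm)

lemma seminorm_diff_commute:
  assumes "v \<in> carrier E" "w \<in> carrier E"
  shows "seminorm E (v \<ominus>\<^bsub>E\<^esub> w) = seminorm E (w \<ominus>\<^bsub>E\<^esub> v)"
  using seminorm_minus[of "v \<ominus>\<^bsub>E\<^esub> w"] assms by (simp add: minus_swap)

lemma diff_add_diff:
  assumes "u \<in> carrier E" "v \<in> carrier E" "w \<in> carrier E"
  shows "(u \<ominus>\<^bsub>E\<^esub> v) \<oplus>\<^bsub>E\<^esub> (v \<ominus>\<^bsub>E\<^esub> w) = u \<ominus>\<^bsub>E\<^esub> w"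
  using assms by (simp add: a_minus_def M.a_assoc M.r_neg1)

lemma seminorm_diff_triangle:
  assumes "u \<in> carrier E" "v \<in> carrier E" "w \<in> carrier E"
  shows "seminorm E (u \<ominus>\<^bsub>E\<^esub> w) \<le> seminorm E (u \<ominus>\<^bsub>E\<^esub> v) + seminorm E (v \<ominus>\<^bsub>E\<^esub> w)"
  using seminorm_add[of "u \<ominus>\<^bsub>E\<^esub> v" "v \<ominus>\<^bsub>E\<^esub> w"] assms by (simp add: diff_add_diff)

lemma minus_zero_right: "v \<in> carrier E \<Longrightarrow> v \<ominus>\<^bsub>E\<^esub> \<zero>\<^bsub>E\<^esub> = v"
  by (simp add: a_minus_def)

lemma seminorm_le_diff:
  assumes "v \<in> carrier E" "w \<in> carrier E"
  shows "seminorm E v \<le> seminorm E (v \<ominus>\<^bsub>E\<^esub> w) + seminorm E w"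
  using seminorm_diff_triangle[of v w "\<zero>\<^bsub>E\<^esub>"] assms by (simp add: minus_zero_right)

lemma seminorm_add_diff_add:
  assumes "v \<in> carrier E" "w \<in> carrier E" "a \<in> carrier E" "b \<in> carrier E"
  shows "seminorm E ((v \<oplus>\<^bsub>E\<^esub> w) \<ominus>\<^bsub>E\<^esub> (a \<oplus>\<^bsub>E\<^esub> b)) \<le> seminorm E (v \<ominus>\<^bsub>E\<^esub> a) + seminorm E (w \<ominus>\<^bsub>E\<^esub> b)"
proof -
  have "(v \<oplus>\<^bsub>E\<^esub> w) \<ominus>\<^bsub>E\<^esub> (a \<oplus>\<^bsub>E\<^esub> b) = (v \<ominus>\<^bsub>E\<^esub> a) \<oplus>\<^bsub>E\<^esub> (w \<ominus>\<^bsub>E\<^esub> b)"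
    using assms by (simp add: a_minus_def M.minus_add M.a_ac)
  then show ?thesis
    using seminorm_add[of "v \<ominus>\<^bsub>E\<^esub> a" "w \<ominus>\<^bsub>E\<^esub> b"] assms by simp
qed

lemma seminorm_smult_diff_smult:
  assumes "v \<in> carrier E" "a \<in> carrier E"
  shows "seminorm E (c \<odot>\<^bsub>E\<^esub> v \<ominus>\<^bsub>E\<^esub> c \<odot>\<^bsub>E\<^esub> a) = cmod c * seminorm E (v \<ominus>\<^bsub>E\<^esub> a)"
  using assms by (simp flip: smult_minus_distr add: seminorm_smult)

lemma seminorm_dist_eq:
  "v \<in> carrier E \<Longrightarrow> w \<in> carrier E \<Longrightarrow> seminorm_dist E v w = seminorm E (v \<ominus>\<^bsub>E\<^esub> w)"
  by (simp add: seminorm_dist_def)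

lemma seminorm_diff_eq_0:
  assumes "\<And>v. v \<in> carrier E \<Longrightarrow> seminorm E v = 0 \<Longrightarrow> v = \<zero>\<^bsub>E\<^esub>" "v \<in> carrier E" "w \<in> carrier E"
  shows "seminorm E (v \<ominus>\<^bsub>E\<^esub> w) = 0 \<longleftrightarrow> v = w"
proof
  assume "seminorm E (v \<ominus>\<^bsub>E\<^esub> w) = 0"
  then have "v \<oplus>\<^bsub>E\<^esub> (\<ominus>\<^bsub>E\<^esub> w) = \<zero>\<^bsub>E\<^esub>"
    using assms by (simp add: a_minus_def)
  then have "\<ominus>\<^bsub>E\<^esub> (\<ominus>\<^bsub>E\<^esub> w) = v"
    using assms by (intro M.minus_equality) auto
  then show "v = w" using assms by simp
next
  assume "v = w"
  then have "v \<ominus>\<^bsub>E\<^esub> w = \<zero>\<^bsub>E\<^esub>" using assms by (simp add: a_minus_def M.r_neg)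
  then show "seminorm E (v \<ominus>\<^bsub>E\<^esub> w) = 0" by (simp add: seminorm_zero)
qed

lemma Metric_space_seminorm_dist:
  assumes "\<And>v. v \<in> carrier E \<Longrightarrow> seminorm E v = 0 \<Longrightarrow> v = \<zero>\<^bsub>E\<^esub>"
  shows "Metric_space (carrier E) (seminorm_dist E)"
proof
  show "0 \<le> seminorm_dist E x y" for x y
    by (simp add: seminorm_dist_def seminorm_nonneg)
  show "seminorm_dist E x y = seminorm_dist E y x" for x y
    by (auto simp: seminorm_dist_def seminorm_diff_commute)
  show "seminorm_dist E x y = 0 \<longleftrightarrow> x = y" if "x \<in> carrier E" "y \<in> carrier E" for x y
    using seminorm_diff_eq_0[OF assms] that by (simp add: seminorm_dist_eq)
  show "seminorm_dist E x z \<le> seminorm_dist E x y + seminorm_dist E y z"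
    if "x \<in> carrier E" "y \<in> carrier E" "z \<in> carrier E" for x y z
    using that by (simp add: seminorm_dist_eq seminorm_diff_triangle)
qed

lemma separable_space_seminorm_dist:
  assumes "\<And>v. v \<in> carrier E \<Longrightarrow> seminorm E v = 0 \<Longrightarrow> v = \<zero>\<^bsub>E\<^esub>"
    and "countable D" "seminorm_dense E D"
  shows "separable_space (Metric_space.mtopology (carrier E) (seminorm_dist E))"
proof -
  interpret D: Metric_space "carrier E" "seminorm_dist E"
    by (rule Metric_space_seminorm_dist) (rule assms(1))
  have D: "D \<subseteq> carrier E" using assms(3) by (simp add: seminorm_dense_def)
  have "D.mtopology closure_of D = carrier E"
  proof -
    have "\<exists>y\<in>D. y \<in> D.mball x r" if "x \<in> carrier E" "r > 0" for x r
      using that assms(3) D unfolding seminorm_dense_def by (meson D.in_mball subsetD)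
    then show ?thesis unfolding D.metric_closure_of by blast
  qed
  then show ?thesis
    unfolding separable_space_def using assms(2) D by auto
qed

end

section \<open>Distances and dense sets under separation-completion\<close>

text \<open>A linear map respects differences. Distances in the image of \<open>\<gamma>\<close> can
  therefore be computed in the original space, where Borel operations are available.\<close>

lemma separation_completion_seminorm_diff:
  assumes "separation_completion E E' \<gamma>" "v \<in> carrier E" "w \<in> carrier E"
  shows "seminorm E' (\<gamma> v \<ominus>\<^bsub>E'\<^esub> \<gamma> w) = seminorm E (v \<ominus>\<^bsub>E\<^esub> w)"
proof -
  interpret E: seminormed E
    using assms(1) by unfold_locales (simp add: separation_completion_def)
  interpret E': seminormed E'
    using assms(1) by unfold_locales (simp add: separation_completion_def banach_space_def)
  have lin: "complex_linear_map E E' \<gamma>" and iso: "\<And>v. v \<in> carrier E \<Longrightarrow> seminorm E' (\<gamma> v) = seminorm E v"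
    using assms(1) by (auto simp: separation_completion_def)
  have cl: "\<gamma> u \<in> carrier E'" if "u \<in> carrier E" for u
    using lin that by (auto simp: complex_linear_map_def)
  have "\<gamma> v \<ominus>\<^bsub>E'\<^esub> \<gamma> w = \<gamma> (v \<ominus>\<^bsub>E\<^esub> w)"
    using lin assms(2,3) cl by (simp add: E.minus_eq_smult E'.minus_eq_smult complex_linear_map_def)
  then show ?thesis using iso assms(2,3) by simp
qed

lemma separation_completion_dense:
  assumes sc: "separation_completion E E' \<gamma>" and D: "seminorm_dense E D"
  shows "seminorm_dense E' (\<gamma> ` D)"
proof -
  interpret E: seminormed E
    using assms(1) by unfold_locales (simp add: separation_completion_def)
  interpret E': seminormed E'
    using assms(1) by unfold_locales (simp add: separation_completion_def banach_space_def)
  have cl: "\<gamma> u \<in> carrier E'" if "u \<in> carrier E" for u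
    using sc that by (auto simp: complex_linear_map_def separation_completion_def)
  have DE: "D \<subseteq> carrier E" using D by (simp add: seminorm_dense_def)
  show ?thesis
    unfolding seminorm_dense_def
  proof (intro conjI ballI allI impI)
    show "\<gamma> ` D \<subseteq> carrier E'" using DE cl by auto
    fix v and e :: real assume v: "v \<in> carrier E'" and e: "e > 0"
    have "seminorm_dense E' (\<gamma> ` carrier E)"
      using sc by (simp add: separation_completion_def)
    then obtain u where u: "u \<in> carrier E" "seminorm_dist E' v (\<gamma> u) < e / 2"
      using v half_gt_zero[OF e] unfolding seminorm_dense_def by blast
    obtain d where d: "d \<in> D" "seminorm_dist E u d < e / 2"
      using u D half_gt_zero[OF e] unfolding seminorm_dense_def by blast
    then have dE: "d \<in> carrier E" using DE by auto
    have "seminorm E' (v \<ominus>\<^bsub>E'\<^esub> \<gamma> d) \<le> seminorm E' (v \<ominus>\<^bsub>E'\<^esub> \<gamma> u) + seminorm E' (\<gamma> u \<ominus>\<^bsub>E'\<^esub> \<gamma> d)"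
      using v u cl dE by (intro E'.seminorm_diff_triangle) auto
    also have "\<dots> < e / 2 + e / 2"
      using u(2) d(2) v cl[OF u(1)] u(1) dE
      by (intro add_strict_mono) (simp_all add: separation_completion_seminorm_diff[OF sc] E.seminorm_dist_eq E'.seminorm_dist_eq)
    finally have "seminorm_dist E' v (\<gamma> d) < e"
      using v cl[OF dE] by (simp add: E'.seminorm_dist_eq)
    then show "\<exists>d\<in>\<gamma> ` D. seminorm_dist E' v d < e" using d(1) by blast
  qed
qed

text \<open>Here \<open>c\<close> stands for the value of a Lipschitz function at a point,
  \<open>H k\<close> for its value at a sample point and \<open>D k\<close> for a bound on the
  change between them. The first inequality makes \<open>c\<close> a lower bound; the second gives
  \<open>D k + H k \<le> c + 2 * D k\<close>, whence the choice \<open>e / 2\<close>.\<close>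

lemma eq_INF_add:
  fixes c :: real and D H :: "'i \<Rightarrow> real"
  assumes "\<And>k. c \<le> D k + H k" "\<And>k. H k \<le> c + D k" "\<And>e. e > 0 \<Longrightarrow> \<exists>k. D k < e"
  shows "c = (INF k. D k + H k)"
proof (rule cInf_eq_non_empty[symmetric])
  show "range (\<lambda>k. D k + H k) \<noteq> {}" by simp
  show "c \<le> x" if "x \<in> range (\<lambda>k. D k + H k)" for x
    using that assms(1) by auto
  fix y assume y: "\<And>x. x \<in> range (\<lambda>k. D k + H k) \<Longrightarrow> y \<le> x"
  show "y \<le> c"
  proof (rule field_le_epsilon)
    fix e :: real assume "e > 0"
    then obtain k where "D k < e / 2" using assms(3)[of "e / 2"] by auto
    moreover have "y \<le> D k + H k" using y by simp
    ultimately show "y \<le> c + e" using assms(2)[of k] by linarith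
  qed
qed

section \<open>Borel fields\<close>

lemma measurable_fibre_product:
  assumes "a \<in> L \<rightarrow>\<^sub>M M" "b \<in> L \<rightarrow>\<^sub>M M" "\<And>l. l \<in> space L \<Longrightarrow> fst (a l) = fst (b l)"
  shows "(\<lambda>l. (a l, b l)) \<in> L \<rightarrow>\<^sub>M fibre_product M"
  unfolding fibre_product_def
  using assms measurable_space[OF assms(1)] measurable_space[OF assms(2)]
  by (intro measurable_restrict_space2 measurable_Pair) auto

lemma space_fibre_product:
  "space (fibre_product M) = {(p, q). p \<in> space M \<and> q \<in> space M \<and> fst p = fst q}"
  by (auto simp: fibre_product_def space_restrict_space space_pair_measure)

lemma measurable_fst_fibre_product: "fst \<in> fibre_product M \<rightarrow>\<^sub>M M"
  and measurable_snd_fibre_product: "snd \<in> fibre_product M \<rightarrow>\<^sub>M M"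
  unfolding fibre_product_def by (auto intro: measurable_restrict_space1)

locale seminormed_field =
  fixes X :: "'x measure" and V :: "'x \<Rightarrow> 'v seminormed_structure" and M :: "('x \<times> 'v) measure"
  assumes field: "borel_field_seminormed X V M"
begin

lemma space_total: "space M = total_space X V"
  using field by (simp add: borel_field_seminormed_def standard_borel_structure_on_def)

lemma seminormed_fibre: "x \<in> space X \<Longrightarrow> seminormed (V x)"
  using field by (auto simp: borel_field_seminormed_def intro: seminormed.intro)

lemma measurable_add:
  assumes "a \<in> L \<rightarrow>\<^sub>M M" "b \<in> L \<rightarrow>\<^sub>M M" "\<And>l. l \<in> space L \<Longrightarrow> fst (a l) = fst (b l)"
  shows "(\<lambda>l. (fst (a l), snd (a l) \<oplus>\<^bsub>V (fst (a l))\<^esub> snd (b l))) \<in> L \<rightarrow>\<^sub>M M"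
proof -
  have "(\<lambda>((x, v), (_, w)). (x, v \<oplus>\<^bsub>V x\<^esub> w)) \<in> fibre_product M \<rightarrow>\<^sub>M M"
    using field by (simp add: borel_field_seminormed_def)
  from measurable_compose[OF measurable_fibre_product[OF assms] this]
  show ?thesis by (simp add: case_prod_beta)
qed

lemma measurable_smult:
  assumes "c \<in> borel_measurable L" "a \<in> L \<rightarrow>\<^sub>M M"
  shows "(\<lambda>l. (fst (a l), c l \<odot>\<^bsub>V (fst (a l))\<^esub> snd (a l))) \<in> L \<rightarrow>\<^sub>M M"
proof -
  have "(\<lambda>(c, (x, v)). (x, c \<odot>\<^bsub>V x\<^esub> v)) \<in> (borel :: complex measure) \<Otimes>\<^sub>M M \<rightarrow>\<^sub>M M"
    using field by (simp add: borel_field_seminormed_def)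
  from measurable_compose[OF measurable_Pair[OF assms] this]
  show ?thesis by (simp add: case_prod_beta)
qed

lemma measurable_seminorm:
  assumes "a \<in> L \<rightarrow>\<^sub>M M"
  shows "(\<lambda>l. seminorm (V (fst (a l))) (snd (a l))) \<in> borel_measurable L"
proof -
  have "(\<lambda>(x, v). seminorm (V x) v) \<in> M \<rightarrow>\<^sub>M (borel :: real measure)"
    using field by (simp add: borel_field_seminormed_def)
  from measurable_compose[OF assms this]
  show ?thesis by (simp add: case_prod_beta)
qed

lemma measurable_diff:
  assumes "a \<in> L \<rightarrow>\<^sub>M M" "b \<in> L \<rightarrow>\<^sub>M M" "\<And>l. l \<in> space L \<Longrightarrow> fst (a l) = fst (b l)"
  shows "(\<lambda>l. (fst (a l), snd (a l) \<ominus>\<^bsub>V (fst (a l))\<^esub> snd (b l))) \<in> L \<rightarrow>\<^sub>M M"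
proof -
  have "(\<lambda>l. (fst (b l), (-1) \<odot>\<^bsub>V (fst (b l))\<^esub> snd (b l))) \<in> L \<rightarrow>\<^sub>M M"
    using measurable_smult[of "\<lambda>_. -1", OF _ assms(2)] by simp
  from measurable_add[OF assms(1) this]
  have "(\<lambda>l. (fst (a l), snd (a l) \<oplus>\<^bsub>V (fst (a l))\<^esub> ((-1) \<odot>\<^bsub>V (fst (b l))\<^esub> snd (b l)))) \<in> L \<rightarrow>\<^sub>M M"
    using assms(3) by simp
  \<comment> \<open>Subtraction agrees with addition of a multiple on carriers, so the two functions
    are compared on the space of \<open>L\<close> and then exchanged there.\<close>
  moreover have "snd (a l) \<ominus>\<^bsub>V (fst (a l))\<^esub> snd (b l) =
      snd (a l) \<oplus>\<^bsub>V (fst (a l))\<^esub> ((-1) \<odot>\<^bsub>V (fst (b l))\<^esub> snd (b l))" if "l \<in> space L" for l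
  proof -
    have "a l \<in> space M" "b l \<in> space M"
      using measurable_space assms that by metis+
    then have x: "fst (a l) \<in> space X" "snd (a l) \<in> carrier (V (fst (a l)))" "snd (b l) \<in> carrier (V (fst (a l)))"
      using assms(3)[OF that] by (auto simp: space_total total_space_def)
    interpret seminormed "V (fst (a l))" by (rule seminormed_fibre) fact
    show ?thesis using minus_eq_smult[OF x(2,3)] assms(3)[OF that] by simp
  qed
  ultimately show ?thesis
    by (subst measurable_cong) auto
qed

text \<open>Differences are Borel as sums with a multiple by -1. For a competing Borel field
  structure this supplies the hypothesis on the metric.\<close>

lemma measurable_fibre_metric: "fibre_metric V \<in> borel_measurable (fibre_product M)"
proof -
  have "(\<lambda>z. (fst (fst z), snd (fst z) \<ominus>\<^bsub>V (fst (fst z))\<^esub> snd (snd z))) \<in> fibre_product M \<rightarrow>\<^sub>M M"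
    by (rule measurable_diff[OF measurable_fst_fibre_product measurable_snd_fibre_product])
      (auto simp: space_fibre_product)
  from measurable_seminorm[OF this] show ?thesis
    by (simp add: fibre_metric_def case_prod_beta')
qed

end

text \<open>
  The base map together with the distances to a dense sequence of sections separates points,
  so it determines the Borel structure.
\<close>

lemma measurable_into_total_space:
  fixes V :: "'x \<Rightarrow> 'v seminormed_structure" and \<psi> :: "nat \<Rightarrow> 'x \<Rightarrow> 'v"
  defines "\<delta> \<equiv> \<lambda>n p. seminorm (V (fst p)) (snd p \<ominus>\<^bsub>V (fst p)\<^esub> \<psi> n (fst p))"
  assumes X: "standard_borel X" and N: "standard_borel_structure_on (total_space X V) N"
    and base: "fst \<in> N \<rightarrow>\<^sub>M X"
    and banach: "\<And>x. x \<in> space X \<Longrightarrow> banach_space (V x)"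
    and dense: "\<And>x. x \<in> space X \<Longrightarrow> seminorm_dense (V x) (range (\<lambda>n. \<psi> n x))"
    and dist: "\<And>n. \<delta> n \<in> borel_measurable N"
    and h: "\<And>l. l \<in> space L \<Longrightarrow> h l \<in> total_space X V" "(\<lambda>l. fst (h l)) \<in> L \<rightarrow>\<^sub>M X"
      "\<And>n. (\<lambda>l. \<delta> n (h l)) \<in> borel_measurable L"
  shows "h \<in> L \<rightarrow>\<^sub>M N"
proof -
  have N': "standard_borel N" "space N = total_space X V"
    using N by (auto simp: standard_borel_structure_on_def)
  obtain \<A> where \<A>: "countable \<A>" "\<A> \<subseteq> sets X"
    "\<And>x y. x \<in> space X \<Longrightarrow> y \<in> space X \<Longrightarrow> x \<noteq> y \<Longrightarrow> \<exists>A\<in>\<A>. (x \<in> A) \<noteq> (y \<in> A)"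
    using standard_borel_countably_separated[OF X] by metis
  \<comment> \<open>Rational thresholds keep the family countable while it still determines all
    distance functions.\<close>
  define \<F> where "\<F> = (\<lambda>A. fst -` A \<inter> space N) ` \<A> \<union>
    (\<lambda>(n, q). {p \<in> space N. \<delta> n p < q}) ` (UNIV \<times> \<rat>)"
  have gen: "sets N = sigma_sets (space N) \<F>"
  proof (rule standard_borel_sets_eq_sigma_sets[OF N'(1)])
    show "countable \<F>" unfolding \<F>_def using \<A>(1) countable_rat by auto
    show "\<F> \<subseteq> sets N" unfolding \<F>_def
      using \<A>(2) measurable_sets[OF base] dist by (auto intro!: borel_measurable_less)
    fix p p' assume pp: "p \<in> space N" "p' \<in> space N" "p \<noteq> p'"
    show "\<exists>A\<in>\<F>. (p \<in> A) \<noteq> (p' \<in> A)"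
    proof (cases "fst p = fst p'")
      case False
      moreover have "fst p \<in> space X" "fst p' \<in> space X"
        using pp by (auto simp: N' total_space_def)
      ultimately obtain A where "A \<in> \<A>" "(fst p \<in> A) \<noteq> (fst p' \<in> A)" using \<A>(3) by metis
      then show ?thesis using pp by (intro bexI[of _ "fst -` A \<inter> space N"]) (auto simp: \<F>_def)
    next
      case True
      obtain x v where p: "p = (x, v)" by fastforce
      obtain w where p': "p' = (x, w)" using True p by (metis fst_conv surj_pair)
      have xv: "x \<in> space X" "v \<in> carrier (V x)" "w \<in> carrier (V x)" "v \<noteq> w"
        using pp p p' by (auto simp: N' total_space_def)
      interpret seminormed "V x"
        using banach[OF xv(1)] by unfold_locales (simp add: banach_space_def)
      define r where "r = seminorm (V x) (v \<ominus>\<^bsub>V x\<^esub> w)"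
      have "r \<noteq> 0"
        using seminorm_diff_eq_0[OF _ xv(2,3)] xv(4) banach[OF xv(1)] by (auto simp: r_def banach_space_def)
      then have r: "r > 0" using seminorm_nonneg[of "v \<ominus>\<^bsub>V x\<^esub> w"] xv by (simp add: r_def)
      have \<psi>: "\<psi> n x \<in> carrier (V x)" for n
        using dense[OF xv(1)] by (auto simp: seminorm_dense_def)
      \<comment> \<open>A section value within \<open>r / 2\<close> of \<open>v\<close> has distance
        at least \<open>r / 2\<close> from \<open>w\<close>, and a rational between the two
        distances gives the separating set.\<close>
      obtain n where "seminorm_dist (V x) v (\<psi> n x) < r / 2"
        using dense[OF xv(1)] xv(2) half_gt_zero[OF r] unfolding seminorm_dense_def by blast
      then have n: "seminorm (V x) (v \<ominus>\<^bsub>V x\<^esub> \<psi> n x) < r / 2"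
        using xv \<psi> by (simp add: seminorm_dist_eq)
      then have "\<delta> n p < r / 2" by (simp add: \<delta>_def p)
      moreover have "r / 2 \<le> \<delta> n p'"
        using seminorm_diff_triangle[OF xv(2) \<psi>[of n] xv(3)] seminorm_diff_commute[OF xv(3) \<psi>[of n]] n
        by (simp add: \<delta>_def p' r_def)
      ultimately obtain q where q: "q \<in> \<rat>" "\<delta> n p < q" "q < \<delta> n p'"
        using Rats_dense_in_real[of "\<delta> n p" "\<delta> n p'"] by auto
      then show ?thesis
        using pp by (intro bexI[of _ "{p \<in> space N. \<delta> n p < q}"]) (auto simp: \<F>_def)
    qed
  qed
  show ?thesis
  proof (rule measurable_sigma_sets[OF gen])
    show "\<F> \<subseteq> Pow (space N)" by (auto simp: \<F>_def)
    show "h \<in> space L \<rightarrow> space N" using h(1) by (simp add: N')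
    fix A assume "A \<in> \<F>"
    then consider B where "B \<in> \<A>" "A = fst -` B \<inter> space N"
      | n q where "A = {p \<in> space N. \<delta> n p < q}"
      by (auto simp: \<F>_def)
    then show "h -` A \<inter> space L \<in> sets L"
    proof cases
      case 1
      then have "h -` A \<inter> space L = (\<lambda>l. fst (h l)) -` B \<inter> space L"
        using h(1) by (auto simp: N')
      then show ?thesis using 1 \<A>(2) measurable_sets[OF h(2)] by auto
    next
      case 2
      then have "h -` A \<inter> space L = {l \<in> space L. \<delta> n (h l) < q}"
        using h(1) by (auto simp: N')
      then show ?thesis using h(3) by (auto intro!: borel_measurable_less)
    qed
  qed
qed

lemma sets_subset_if_id_measurable:
  assumes "(\<lambda>x. x) \<in> M \<rightarrow>\<^sub>M N" "space M = space N"
  shows "sets N \<subseteq> sets M"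
proof
  fix A assume A: "A \<in> sets N"
  then have "A \<inter> space M = A"
    using assms(2) sets.sets_into_space by blast
  then show "A \<in> sets M"
    using measurable_sets[OF assms(1) A] by simp
qed

section \<open>The Borel structure on the completed field\<close>

text \<open>The sections \<open>\<phi>\<close> are parameters, so \<open>\<psi>\<close> and
  \<open>\<delta>\<close> depend on \<open>V'\<close>, \<open>\<gamma>\<close> and
  \<open>\<phi>\<close> but not on \<open>N\<close>. Two Borel structures on the same total space
  thus share the same distance functions.\<close>

locale completion_field = V: seminormed_field X V MV
  for X :: "'x measure" and V :: "'x \<Rightarrow> 'v seminormed_structure" and MV :: "('x \<times> 'v) measure" +
  fixes V' :: "'x \<Rightarrow> 'w seminormed_structure" and N :: "('x \<times> 'w) measure"
    and \<gamma> :: "'x \<Rightarrow> 'v \<Rightarrow> 'w" and \<phi> :: "nat \<Rightarrow> 'x \<Rightarrow> 'x \<times> 'v"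
  assumes completion: "\<And>x. x \<in> space X \<Longrightarrow> separation_completion (V x) (V' x) (\<gamma> x)"
    and standard: "standard_borel_structure_on (total_space X V') N"
    and base: "fst \<in> N \<rightarrow>\<^sub>M X"
    and total_map: "total_map \<gamma> \<in> MV \<rightarrow>\<^sub>M N"
    and fibre_metric: "fibre_metric V' \<in> borel_measurable (fibre_product N)"
    and sections: "\<And>n. borel_section X MV (\<phi> n)"
    and dense: "\<And>x. x \<in> space X \<Longrightarrow> seminorm_dense (V x) (range (\<lambda>n. snd (\<phi> n x)))"
begin

definition \<psi> :: "nat \<Rightarrow> 'x \<Rightarrow> 'w" where
  "\<psi> n x = \<gamma> x (snd (\<phi> n x))"

definition \<delta> :: "nat \<Rightarrow> 'x \<times> 'w \<Rightarrow> real" where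
  "\<delta> n p = seminorm (V' (fst p)) (snd p \<ominus>\<^bsub>V' (fst p)\<^esub> \<psi> n (fst p))"

lemma space_N: "space N = total_space X V'"
  using standard by (simp add: standard_borel_structure_on_def)

lemma in_space_N: "p \<in> space N \<longleftrightarrow> fst p \<in> space X \<and> snd p \<in> carrier (V' (fst p))"
  by (cases p) (simp add: space_N total_space_def)

lemma \<phi>_measurable: "\<phi> n \<in> X \<rightarrow>\<^sub>M MV"
  and fst_\<phi>: "x \<in> space X \<Longrightarrow> fst (\<phi> n x) = x"
  using sections by (auto simp: borel_section_def)

lemma snd_\<phi>: "x \<in> space X \<Longrightarrow> snd (\<phi> n x) \<in> carrier (V x)"
  using dense by (auto simp: seminorm_dense_def)

lemma banach: "x \<in> space X \<Longrightarrow> banach_space (V' x)"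
  using completion by (auto simp: separation_completion_def)

lemma seminormed': "x \<in> space X \<Longrightarrow> seminormed (V' x)"
  using banach by (auto simp: banach_space_def intro: seminormed.intro)

lemma \<psi>_dense:
  assumes "x \<in> space X"
  shows "seminorm_dense (V' x) (range (\<lambda>n. \<psi> n x))"
  using separation_completion_dense[OF completion dense, OF assms assms]
  by (simp add: \<psi>_def image_image)

lemma \<psi>_carrier: "x \<in> space X \<Longrightarrow> \<psi> n x \<in> carrier (V' x)"
  using \<psi>_dense by (auto simp: seminorm_dense_def)

lemma \<psi>_measurable: "(\<lambda>x. (x, \<psi> n x)) \<in> X \<rightarrow>\<^sub>M N"
proof -
  have "(\<lambda>x. total_map \<gamma> (\<phi> n x)) \<in> X \<rightarrow>\<^sub>M N"
    using \<phi>_measurable total_map by (rule measurable_compose)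
  moreover have "total_map \<gamma> (\<phi> n x) = (x, \<psi> n x)" if "x \<in> space X" for x
    using fst_\<phi>[OF that] by (simp add: total_map_def \<psi>_def case_prod_beta')
  ultimately show ?thesis by (simp cong: measurable_cong)
qed

lemma \<delta>_measurable: "\<delta> n \<in> borel_measurable N"
proof -
  have "(\<lambda>p. (p, (fst p, \<psi> n (fst p)))) \<in> N \<rightarrow>\<^sub>M fibre_product N"
    by (rule measurable_fibre_product) (auto intro: measurable_compose[OF base \<psi>_measurable])
  from measurable_compose[OF this fibre_metric] show ?thesis
    by (simp add: fibre_metric_def case_prod_beta \<delta>_def[abs_def])
qed

lemma \<delta>_nonneg:
  assumes "p \<in> space N"
  shows "0 \<le> \<delta> n p"
proof -
  have p: "fst p \<in> space X" "snd p \<in> carrier (V' (fst p))" using assms by (auto simp: in_space_N)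
  interpret seminormed "V' (fst p)" by (rule seminormed') fact
  show ?thesis using p \<psi>_carrier by (simp add: \<delta>_def seminorm_nonneg)
qed

lemma \<delta>_small:
  assumes "p \<in> space N" "e > 0"
  shows "\<exists>k. \<delta> k p < e"
proof -
  have p: "fst p \<in> space X" "snd p \<in> carrier (V' (fst p))" using assms by (auto simp: in_space_N)
  then have "\<exists>k. seminorm_dist (V' (fst p)) (snd p) (\<psi> k (fst p)) < e"
    using \<psi>_dense assms(2) unfolding seminorm_dense_def by blast
  then show ?thesis using p \<psi>_carrier by (simp add: \<delta>_def seminorm_dist_def)
qed

lemma measurable_into:
  assumes "\<And>l. l \<in> space L \<Longrightarrow> h l \<in> space N" "(\<lambda>l. fst (h l)) \<in> L \<rightarrow>\<^sub>M X"
    "\<And>n. (\<lambda>l. \<delta> n (h l)) \<in> borel_measurable L"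
  shows "h \<in> L \<rightarrow>\<^sub>M N"
proof (rule measurable_into_total_space[OF _ standard base banach \<psi>_dense])
  show "standard_borel X" using V.field by (simp add: borel_field_seminormed_def)
qed (use assms \<delta>_measurable in \<open>simp_all add: space_N \<delta>_def[abs_def]\<close>)

text \<open>
  By density, a Lipschitz function of points of the fibre is the infimum over \<open>k\<close> of its value at
  \<open>\<psi> k\<close> plus the Lipschitz constant times \<open>\<delta> k\<close>. Applied to the distance of a sum or a multiple to
  \<open>\<psi> n\<close>, this leaves only values on the image of \<open>\<gamma>\<close>, which are computed in \<open>V\<close>.
\<close>

lemma add_measurable:
  "(\<lambda>((x, v), (_, w)). (x, v \<oplus>\<^bsub>V' x\<^esub> w)) \<in> fibre_product N \<rightarrow>\<^sub>M N"
proof -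
  define h where "h = (\<lambda>z :: ('x \<times> 'w) \<times> ('x \<times> 'w).
    (fst (fst z), snd (fst z) \<oplus>\<^bsub>V' (fst (fst z))\<^esub> snd (snd z)))"
  define G where "G = (\<lambda>k l n x. seminorm (V' x) ((\<psi> k x \<oplus>\<^bsub>V' x\<^esub> \<psi> l x) \<ominus>\<^bsub>V' x\<^esub> \<psi> n x))"
  let ?L = "fibre_product N"
  have L: "fst z \<in> space N" "snd z \<in> space N" "fst (snd z) = fst (fst z)" if "z \<in> space ?L" for z
    using that by (auto simp: space_fibre_product)
  have base_L: "(\<lambda>z. fst (fst z)) \<in> ?L \<rightarrow>\<^sub>M X"
    using measurable_fst_fibre_product base by (rule measurable_compose)
  have G_measurable: "G k l n \<in> borel_measurable X" for k l n
  proof -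
    have "(\<lambda>x. (fst (\<phi> k x), (snd (\<phi> k x) \<oplus>\<^bsub>V (fst (\<phi> k x))\<^esub> snd (\<phi> l x)) \<ominus>\<^bsub>V (fst (\<phi> k x))\<^esub> snd (\<phi> n x)))
        \<in> X \<rightarrow>\<^sub>M MV"
      using V.measurable_diff[OF V.measurable_add[OF \<phi>_measurable[of k] \<phi>_measurable[of l]] \<phi>_measurable[of n]]
      by (simp add: fst_\<phi>)
    from V.measurable_seminorm[OF this]
    have "(\<lambda>x. seminorm (V (fst (\<phi> k x)))
        ((snd (\<phi> k x) \<oplus>\<^bsub>V (fst (\<phi> k x))\<^esub> snd (\<phi> l x)) \<ominus>\<^bsub>V (fst (\<phi> k x))\<^esub> snd (\<phi> n x))) \<in> borel_measurable X"
      by simp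
    moreover have "seminorm (V (fst (\<phi> k x)))
        ((snd (\<phi> k x) \<oplus>\<^bsub>V (fst (\<phi> k x))\<^esub> snd (\<phi> l x)) \<ominus>\<^bsub>V (fst (\<phi> k x))\<^esub> snd (\<phi> n x)) = G k l n x"
      if x: "x \<in> space X" for x
    proof -
      interpret seminormed "V x" using x by (rule V.seminormed_fibre)
      have "\<psi> k x \<oplus>\<^bsub>V' x\<^esub> \<psi> l x = \<gamma> x (snd (\<phi> k x) \<oplus>\<^bsub>V x\<^esub> snd (\<phi> l x))"
        using completion[OF x] snd_\<phi>[OF x]
        by (simp add: \<psi>_def separation_completion_def complex_linear_map_def)
      then show ?thesis
        using separation_completion_seminorm_diff[OF completion[OF x]] snd_\<phi>[OF x] fst_\<phi>[OF x]
        by (simp add: G_def \<psi>_def)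
    qed
    ultimately show ?thesis by (simp cong: measurable_cong)
  qed
  \<comment> \<open>The two summands are approximated independently, hence an infimum over pairs of
    indices and a sum of two distances as error bound.\<close>
  have INF: "\<delta> n (h z) = (INF (k, l). (\<delta> k (fst z) + \<delta> l (snd z)) + G k l n (fst (fst z)))"
    if z: "z \<in> space ?L" for n z
  proof -
    obtain x v w where zeq: "z = ((x, v), (x, w))"
      using L(3)[OF z] by (metis prod.collapse)
    then have x: "x \<in> space X" "v \<in> carrier (V' x)" "w \<in> carrier (V' x)"
      using L[OF z] by (auto simp: in_space_N)
    interpret seminormed "V' x" using x(1) by (rule seminormed')
    note \<psi> = \<psi>_carrier[OF x(1)]
    have "\<delta> n (h z) = (INF i. (\<delta> (fst i) (fst z) + \<delta> (snd i) (snd z)) + G (fst i) (snd i) n x)"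
    proof (rule eq_INF_add)
      fix i :: "nat \<times> nat"
      let ?a = "\<psi> (fst i) x" and ?b = "\<psi> (snd i) x"
      have *: "seminorm (V' x) ((v \<oplus>\<^bsub>V' x\<^esub> w) \<ominus>\<^bsub>V' x\<^esub> (?a \<oplus>\<^bsub>V' x\<^esub> ?b)) \<le> \<delta> (fst i) (fst z) + \<delta> (snd i) (snd z)"
        using seminorm_add_diff_add[of v w ?a ?b] x \<psi> by (simp add: \<delta>_def zeq)
      show "\<delta> n (h z) \<le> \<delta> (fst i) (fst z) + \<delta> (snd i) (snd z) + G (fst i) (snd i) n x"
        using * seminorm_diff_triangle[of "v \<oplus>\<^bsub>V' x\<^esub> w" "?a \<oplus>\<^bsub>V' x\<^esub> ?b" "\<psi> n x"] x \<psi>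
        by (simp add: \<delta>_def[of n] h_def zeq G_def)
      show "G (fst i) (snd i) n x \<le> \<delta> n (h z) + (\<delta> (fst i) (fst z) + \<delta> (snd i) (snd z))"
        using * seminorm_diff_triangle[of "?a \<oplus>\<^bsub>V' x\<^esub> ?b" "v \<oplus>\<^bsub>V' x\<^esub> w" "\<psi> n x"]
          seminorm_diff_commute[of "v \<oplus>\<^bsub>V' x\<^esub> w" "?a \<oplus>\<^bsub>V' x\<^esub> ?b"] x \<psi>
        by (simp add: \<delta>_def[of n] h_def zeq G_def)
    next
      fix e :: real assume "e > 0"
      then have "e / 2 > 0" by simp
      obtain k where "\<delta> k (fst z) < e / 2" using \<delta>_small[OF L(1)[OF z] \<open>e / 2 > 0\<close>] by blast
      moreover obtain l where "\<delta> l (snd z) < e / 2" using \<delta>_small[OF L(2)[OF z] \<open>e / 2 > 0\<close>] by blast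
      ultimately show "\<exists>i. \<delta> (fst i) (fst z) + \<delta> (snd i) (snd z) < e"
        by (intro exI[of _ "(k, l)"]) simp
    qed
    then show ?thesis by (simp add: zeq case_prod_beta')
  qed
  have "h \<in> ?L \<rightarrow>\<^sub>M N"
  proof (rule measurable_into)
    fix z assume z: "z \<in> space ?L"
    have x: "fst (fst z) \<in> space X" using L(1)[OF z] by (simp add: in_space_N)
    interpret seminormed "V' (fst (fst z))" using x by (rule seminormed')
    show "h z \<in> space N" using L[OF z] by (auto simp: in_space_N h_def)
  next
    show "(\<lambda>z. fst (h z)) \<in> ?L \<rightarrow>\<^sub>M X" using base_L by (simp add: h_def)
  next
    fix n
    have "(\<lambda>z. INF (k, l). (\<delta> k (fst z) + \<delta> l (snd z)) + G k l n (fst (fst z))) \<in> borel_measurable ?L"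
      unfolding case_prod_beta'
      by (intro borel_measurable_cINF_real borel_measurable_add
          measurable_compose[OF measurable_fst_fibre_product \<delta>_measurable]
          measurable_compose[OF measurable_snd_fibre_product \<delta>_measurable]
          measurable_compose[OF base_L G_measurable]) auto
    then show "(\<lambda>z. \<delta> n (h z)) \<in> borel_measurable ?L"
      by (simp add: INF cong: measurable_cong)
  qed
  then show ?thesis by (simp add: h_def case_prod_beta')
qed

lemma smult_measurable:
  "(\<lambda>(c, (x, v)). (x, c \<odot>\<^bsub>V' x\<^esub> v)) \<in> (borel :: complex measure) \<Otimes>\<^sub>M N \<rightarrow>\<^sub>M N"
proof -
  define h where "h = (\<lambda>z :: complex \<times> ('x \<times> 'w). (fst (snd z), fst z \<odot>\<^bsub>V' (fst (snd z))\<^esub> snd (snd z)))"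
  \<comment> \<open>The scalar is an argument of the map, so unlike for sums these values depend on
    all of \<open>z\<close> and are shown to be Borel on the product.\<close>
  define G where "G = (\<lambda>k n (z :: complex \<times> ('x \<times> 'w)). seminorm (V' (fst (snd z)))
    (fst z \<odot>\<^bsub>V' (fst (snd z))\<^esub> \<psi> k (fst (snd z)) \<ominus>\<^bsub>V' (fst (snd z))\<^esub> \<psi> n (fst (snd z))))"
  let ?L = "(borel :: complex measure) \<Otimes>\<^sub>M N"
  have L: "snd z \<in> space N" if "z \<in> space ?L" for z
    using that by (auto simp: space_pair_measure)
  have base_L: "(\<lambda>z. fst (snd z)) \<in> ?L \<rightarrow>\<^sub>M X"
    using measurable_snd base by (rule measurable_compose)
  have G_measurable: "G k n \<in> borel_measurable ?L" for k n
  proof -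
    let ?x = "\<lambda>z :: complex \<times> ('x \<times> 'w). fst (snd z)"
    have x: "?x z \<in> space X" if "z \<in> space ?L" for z using L[OF that] by (simp add: in_space_N)
    note \<phi>L = measurable_compose[OF base_L \<phi>_measurable]
    have "(\<lambda>z. seminorm (V (fst (\<phi> k (?x z)))) (fst z \<odot>\<^bsub>V (fst (\<phi> k (?x z)))\<^esub> snd (\<phi> k (?x z))
        \<ominus>\<^bsub>V (fst (\<phi> k (?x z)))\<^esub> snd (\<phi> n (?x z)))) \<in> borel_measurable ?L"
      using V.measurable_seminorm[OF V.measurable_diff[OF V.measurable_smult[OF measurable_fst \<phi>L[of k]] \<phi>L[of n]]] x
      by (simp add: fst_\<phi>)
    moreover have "seminorm (V (fst (\<phi> k (?x z)))) (fst z \<odot>\<^bsub>V (fst (\<phi> k (?x z)))\<^esub> snd (\<phi> k (?x z))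
        \<ominus>\<^bsub>V (fst (\<phi> k (?x z)))\<^esub> snd (\<phi> n (?x z))) = G k n z" if z: "z \<in> space ?L" for z
    proof -
      interpret seminormed "V (?x z)" using x[OF z] by (rule V.seminormed_fibre)
      have "fst z \<odot>\<^bsub>V' (?x z)\<^esub> \<psi> k (?x z) = \<gamma> (?x z) (fst z \<odot>\<^bsub>V (?x z)\<^esub> snd (\<phi> k (?x z)))"
        using completion[OF x[OF z]] snd_\<phi>[OF x[OF z]]
        by (simp add: \<psi>_def separation_completion_def complex_linear_map_def)
      then show ?thesis
        using separation_completion_seminorm_diff[OF completion[OF x[OF z]]] snd_\<phi>[OF x[OF z]] fst_\<phi>[OF x[OF z]]
        by (simp add: G_def \<psi>_def)
    qed
    ultimately show ?thesis by (simp cong: measurable_cong)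
  qed
  have INF: "\<delta> n (h z) = (INF k. cmod (fst z) * \<delta> k (snd z) + G k n z)" if z: "z \<in> space ?L" for n z
  proof (rule eq_INF_add)
    obtain c x v where zeq: "z = (c, (x, v))" by (metis prod.collapse)
    then have x: "x \<in> space X" "v \<in> carrier (V' x)" using L[OF z] by (auto simp: in_space_N)
    interpret seminormed "V' x" using x(1) by (rule seminormed')
    note \<psi> = \<psi>_carrier[OF x(1)]
    fix k
    let ?a = "\<psi> k x"
    have *: "seminorm (V' x) (c \<odot>\<^bsub>V' x\<^esub> v \<ominus>\<^bsub>V' x\<^esub> c \<odot>\<^bsub>V' x\<^esub> ?a) = cmod (fst z) * \<delta> k (snd z)"
      using seminorm_smult_diff_smult[of v ?a c] x \<psi> by (simp add: \<delta>_def zeq)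
    show "\<delta> n (h z) \<le> cmod (fst z) * \<delta> k (snd z) + G k n z"
      using * seminorm_diff_triangle[of "c \<odot>\<^bsub>V' x\<^esub> v" "c \<odot>\<^bsub>V' x\<^esub> ?a" "\<psi> n x"] x \<psi>
      by (simp add: \<delta>_def[of n] h_def zeq G_def)
    show "G k n z \<le> \<delta> n (h z) + cmod (fst z) * \<delta> k (snd z)"
      using * seminorm_diff_triangle[of "c \<odot>\<^bsub>V' x\<^esub> ?a" "c \<odot>\<^bsub>V' x\<^esub> v" "\<psi> n x"]
        seminorm_diff_commute[of "c \<odot>\<^bsub>V' x\<^esub> v" "c \<odot>\<^bsub>V' x\<^esub> ?a"] x \<psi>
      by (simp add: \<delta>_def[of n] h_def zeq G_def)
  next
    fix e :: real assume e: "e > 0"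
    \<comment> \<open>The Lipschitz constant \<open>cmod (fst z)\<close> may vanish; adding 1 gives
      a divisor that is always positive.\<close>
    have c: "cmod (fst z) + 1 > 0" by (simp add: add_nonneg_pos)
    then obtain k where k: "\<delta> k (snd z) < e / (cmod (fst z) + 1)"
      using \<delta>_small[OF L[OF z], of "e / (cmod (fst z) + 1)"] e by auto
    have "cmod (fst z) * \<delta> k (snd z) \<le> (cmod (fst z) + 1) * \<delta> k (snd z)"
      using \<delta>_nonneg[OF L[OF z]] by (intro mult_right_mono) auto
    also have "\<dots> < e" using k c by (simp add: pos_less_divide_eq mult.commute)
    finally show "\<exists>k. cmod (fst z) * \<delta> k (snd z) < e" ..
  qed
  have "h \<in> ?L \<rightarrow>\<^sub>M N"
  proof (rule measurable_into)
    fix z assume z: "z \<in> space ?L"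
    have x: "fst (snd z) \<in> space X" using L[OF z] by (simp add: in_space_N)
    interpret seminormed "V' (fst (snd z))" using x by (rule seminormed')
    show "h z \<in> space N" using L[OF z] by (auto simp: in_space_N h_def)
  next
    show "(\<lambda>z. fst (h z)) \<in> ?L \<rightarrow>\<^sub>M X" using base_L by (simp add: h_def)
  next
    fix n
    have "(\<lambda>z. INF k. cmod (fst z) * \<delta> k (snd z) + G k n z) \<in> borel_measurable ?L"
      by (intro borel_measurable_cINF_real borel_measurable_add borel_measurable_times
          borel_measurable_norm measurable_fst measurable_compose[OF measurable_snd \<delta>_measurable] G_measurable)
        auto
    then show "(\<lambda>z. \<delta> n (h z)) \<in> borel_measurable ?L"
      by (simp add: INF cong: measurable_cong)
  qed
  then show ?thesis by (simp add: h_def case_prod_beta')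
qed

text \<open>The norm changes by at most the distance, so it is the infimum of
  \<open>\<delta> k\<close> plus the norm of \<open>\<psi> k\<close>, and the latter equals the
  seminorm of the Borel section \<open>\<phi> k\<close>.\<close>

lemma seminorm_measurable: "(\<lambda>(x, v). seminorm (V' x) v) \<in> borel_measurable N"
proof -
  have "(\<lambda>x. seminorm (V (fst (\<phi> k x))) (snd (\<phi> k x))) \<in> borel_measurable X" for k
    using V.measurable_seminorm[OF \<phi>_measurable] .
  moreover have "seminorm (V (fst (\<phi> k x))) (snd (\<phi> k x)) = seminorm (V' x) (\<psi> k x)"
    if "x \<in> space X" for k x
    using completion[OF that] snd_\<phi>[OF that] fst_\<phi>[OF that] by (simp add: separation_completion_def \<psi>_def)
  ultimately have G: "(\<lambda>x. seminorm (V' x) (\<psi> k x)) \<in> borel_measurable X" for k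
    by (simp cong: measurable_cong)
  have "(\<lambda>p. INF k. \<delta> k p + seminorm (V' (fst p)) (\<psi> k (fst p))) \<in> borel_measurable N"
    by (intro borel_measurable_cINF_real borel_measurable_add \<delta>_measurable measurable_compose[OF base G]) auto
  moreover have "seminorm (V' (fst p)) (snd p) = (INF k. \<delta> k p + seminorm (V' (fst p)) (\<psi> k (fst p)))"
    if p: "p \<in> space N" for p
  proof (rule eq_INF_add)
    have x: "fst p \<in> space X" "snd p \<in> carrier (V' (fst p))" using p by (auto simp: in_space_N)
    interpret seminormed "V' (fst p)" using x(1) by (rule seminormed')
    note \<psi> = \<psi>_carrier[OF x(1)]
    show "seminorm (V' (fst p)) (snd p) \<le> \<delta> k p + seminorm (V' (fst p)) (\<psi> k (fst p))" for k
      using seminorm_le_diff[OF x(2) \<psi>] by (simp add: \<delta>_def)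
    show "seminorm (V' (fst p)) (\<psi> k (fst p)) \<le> seminorm (V' (fst p)) (snd p) + \<delta> k p" for k
      using seminorm_le_diff[OF \<psi>[of k] x(2)] seminorm_diff_commute[OF x(2) \<psi>[of k]] by (simp add: \<delta>_def)
  qed (rule \<delta>_small[OF p])
  ultimately show ?thesis
    by (simp add: case_prod_beta' cong: measurable_cong)
qed

lemma separable:
  assumes "x \<in> space X"
  shows "separable_banach_space (V' x)"
proof -
  interpret seminormed "V' x" using assms by (rule seminormed')
  have "separable_space (Metric_space.mtopology (carrier (V' x)) (seminorm_dist (V' x)))"
    using banach[OF assms]
    by (intro separable_space_seminorm_dist[OF _ _ \<psi>_dense[OF assms]]) (auto simp: banach_space_def)
  then show ?thesis using banach[OF assms] by (simp add: separable_banach_space_def)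
qed

lemma borel_field_banach: "borel_field_banach X V' N"
  unfolding borel_field_banach_def borel_field_seminormed_def
proof (intro conjI ballI exI[of _ "\<lambda>n x. (x, \<psi> n x)"] allI)
  show "standard_borel X" using V.field by (simp add: borel_field_seminormed_def)
  show "borel_section X N (\<lambda>x. (x, \<psi> n x))" for n
    using \<psi>_measurable by (simp add: borel_section_def)
qed (use seminormed' standard base add_measurable smult_measurable seminorm_measurable \<psi>_dense separable
    in \<open>simp_all add: seminormed_def\<close>)

end

theorem corollary6p4:
  fixes X :: "'x measure"
    and V :: "'x \<Rightarrow> 'v seminormed_structure"
    and MV :: "('x \<times> 'v) measure"
    and V' :: "'x \<Rightarrow> 'w seminormed_structure"
    and MV' :: "('x \<times> 'w) measure"
    and \<gamma> :: "'x \<Rightarrow> 'v \<Rightarrow> 'w"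
  assumes "standard_borel X"
    and "borel_field_seminormed X V MV"
    and "\<forall>x\<in>space X. separation_completion (V x) (V' x) (\<gamma> x)"
    and "standard_borel_structure_on (total_space X V') MV'"
    and "fst \<in> MV' \<rightarrow>\<^sub>M X"
    and "total_map \<gamma> \<in> MV \<rightarrow>\<^sub>M MV'"
    and "fibre_metric V' \<in> fibre_product MV' \<rightarrow>\<^sub>M (borel :: real measure)"
  shows "borel_field_banach X V' MV' \<and>
    (\<forall>N :: ('x \<times> 'w) measure.
       standard_borel_structure_on (total_space X V') N \<and>
       fst \<in> N \<rightarrow>\<^sub>M X \<and>
       total_map \<gamma> \<in> MV \<rightarrow>\<^sub>M N \<and>
       borel_field_banach X V' N \<longrightarrow>
       sets N = sets MV')"
proof -
  obtain \<phi> :: "nat \<Rightarrow> 'x \<Rightarrow> 'x \<times> 'v" where \<phi>: "\<And>n. borel_section X MV (\<phi> n)"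
    "\<And>x. x \<in> space X \<Longrightarrow> seminorm_dense (V x) (range (\<lambda>n. snd (\<phi> n x)))"
    using assms(2) unfolding borel_field_seminormed_def by metis
  interpret M: completion_field X V MV V' MV' \<gamma> \<phi>
    using assms \<phi> by unfold_locales auto
  have "sets N = sets MV'"
    if N: "standard_borel_structure_on (total_space X V') N" "fst \<in> N \<rightarrow>\<^sub>M X"
      "total_map \<gamma> \<in> MV \<rightarrow>\<^sub>M N" "borel_field_banach X V' N" for N
  proof -
    interpret B: seminormed_field X V' N
      using N(4) by unfold_locales (simp add: borel_field_banach_def)
    \<comment> \<open>The competing structure has a Borel fibre metric, being a Borel field, so it
      meets the same assumptions; taking the same \<open>\<phi>\<close> makes the distance functions
      coincide.\<close>
    interpret N: completion_field X V MV V' N \<gamma> \<phi>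
      using assms N \<phi> B.measurable_fibre_metric by unfold_locales auto
    \<comment> \<open>Each structure makes the base map and the common distances Borel, and these
      are what the criterion for maps into the other structure asks of the identity.\<close>
    have "(\<lambda>p. p) \<in> N \<rightarrow>\<^sub>M MV'"
      using N.\<delta>_measurable
      by (intro M.measurable_into) (simp_all add: M.space_N N.space_N N.base)
    moreover have "(\<lambda>p. p) \<in> MV' \<rightarrow>\<^sub>M N"
      using M.\<delta>_measurable
      by (intro N.measurable_into) (simp_all add: M.space_N N.space_N M.base)
    ultimately show ?thesis
      by (intro antisym sets_subset_if_id_measurable) (simp_all add: M.space_N N.space_N)
  qed
  then show ?thesis
    using M.borel_field_banach by blast
qed

end
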